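(* There is an absolute constant $C$ such that the following holds for every $n\ge2$. Let $\mathcal{F}$ be a family of $n$ closed discs in the plane, and assign to each $D\in\mathcal{F}$ a list $L_D$ of at least $C\log n$ colors (with no assumption on the relation between different lists). Then one can choose for each $D\in\mathcal{F}$ a color from $L_D$ such that for every closed disc $B$ in the plane for which $S_B=\{D\in\mathcal{F}: D\cap B\neq\emptyset\}$ is nonempty, $S_B$ contains an element whose color differs from the colors of all other elements of $S_B$. The bound $O(\log n)$ on the list size is asymptotically tight. *)

theory Defs
  imports "HOL-Analysis.Analysis"
begin

definition closed_disc :: "(real^2) set \<Rightarrow> bool" where
  "closed_disc D \<longleftrightarrow> (\<exists>c r. r > 0 \<and> D = cball c r)"

definition hit_set :: "(real^2) set set \<Rightarrow> (real^2) set \<Rightarrow> (real^2) set set" where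
  "hit_set F B = {D \<in> F. D \<inter> B \<noteq> {}}"

definition cf_disc_coloring :: "(real^2) set set \<Rightarrow> ((real^2) set \<Rightarrow> nat) \<Rightarrow> bool" where
  "cf_disc_coloring F col \<longleftrightarrow>
     (\<forall>B. closed_disc B \<longrightarrow> hit_set F B \<noteq> {} \<longrightarrow>
        (\<exists>D\<in>hit_set F B. \<forall>D'\<in>hit_set F B. D' \<noteq> D \<longrightarrow> col D' \<noteq> col D))"

end

(* Upper bound. A closed disc meets D(c,r) iff |b - c| <= r + s, i.e. iff the point (c,-r) of
   2+1 dimensional Minkowski space lies in the causal past of the point (b,s). So the hypergraph is
   that of causal pasts, restricted to a finite set P. If it always has a proper colouring with
   K colours on every subfamily, lists with sum of (1-1/K)^|L D| below 1 suffice: give a colour c to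
   the heaviest colour class among the discs whose list contains c, delete c elsewhere, and iterate;
   the weight never increases. Proper colourings come from degeneracy: only traces {p,q} matter,
   and these pairs number at most 7|P| when no point of P precedes another (otherwise some point has
   at most one neighbour). They are counted as in Fortune's sweep-line algorithm, with the null
   coordinate u as sweep direction: walking down the boundary between the cells of p and q one either
   reaches the bottom, which determines q from p, or a point where the cell of a third point b ends.
   Between two such ends of the same cell some later point is born inside it, so there are at most
   2|P| of them.

   Lower bound. Small discs centred at 0, 1, ..., 2^m - 1 on a line realise all intervals, and a
   conflict-free colouring of all intervals of 2^m points needs more than m colours. *)
theory Submission
  imports Defs
begin

section \<open>Conflict-free list colouring from hereditary proper colouring\<close>

lemma list_conflict_free:
  fixes H :: "'a set set" and L :: "'a \<Rightarrow> 'c set" and K :: nat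
  assumes "finite Cs" and K: "K \<ge> 2" and "finite V"
    and colorable: "\<And>P. P \<subseteq> V \<Longrightarrow> \<exists>f::'a \<Rightarrow> nat. (\<forall>a\<in>P. f a < K) \<and>
          (\<forall>h\<in>H. (\<forall>a\<in>h \<inter> P. \<forall>b\<in>h \<inter> P. f a = f b) \<longrightarrow> card (h \<inter> P) \<le> 1)"
    and "\<And>v. v \<in> V \<Longrightarrow> L v \<subseteq> Cs"
    and "(\<Sum>v\<in>V. (1 - 1 / real K) ^ card (L v)) < 1"
  shows "\<exists>col. (\<forall>v\<in>V. col v \<in> L v) \<and>
          (\<forall>h\<in>H. h \<inter> V \<noteq> {} \<longrightarrow> (\<exists>v\<in>h \<inter> V. \<forall>w\<in>h \<inter> V. w \<noteq> v \<longrightarrow> col w \<noteq> col v))"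
  using assms(1,3-)
proof (induction Cs arbitrary: V L rule: finite_induct)
  case empty
  \<comment> \<open>Without colours every list is empty and every vertex weighs 1, so a weight below
    1 leaves no vertex.\<close>
  then have "real (card V) < 1" by simp
  then have "V = {}" using empty(1) by simp
  then show ?case by simp
next
  case (insert c Cs)
  define q where "q = 1 - 1 / real K"
  have q: "0 < q" "q < 1" using K by (auto simp: q_def)
  define Vc where "Vc = {v \<in> V. c \<in> L v}"
  have fin: "finite V" "finite Vc" and Vc: "Vc \<subseteq> V" using insert.prems(1) by (auto simp: Vc_def)
  have finL: "finite (L v)" if "v \<in> V" for v
    using insert.prems(3)[OF that] insert.hyps(1) finite_subset by blast
  obtain f :: "'a \<Rightarrow> nat" where f: "\<And>a. a \<in> Vc \<Longrightarrow> f a < K"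
    and mono: "\<And>h. h \<in> H \<Longrightarrow> \<forall>a\<in>h \<inter> Vc. \<forall>b\<in>h \<inter> Vc. f a = f b \<Longrightarrow> card (h \<inter> Vc) \<le> 1"
    using insert.prems(2)[OF Vc] by metis
  define w where "w = (\<lambda>A. \<Sum>v\<in>A. q ^ card (L v))"
  define cl where "cl = (\<lambda>i. {v \<in> Vc. f v = i})"
  have "w Vc = (\<Sum>i<K. w (cl i))"
    unfolding w_def cl_def using f fin(2) by (intro sum.group[symmetric]) auto
  moreover have "\<exists>i<K. w Vc / K \<le> w (cl i)"
  proof (rule ccontr)
    assume "\<not> ?thesis"
    then have "(\<Sum>i<K. w (cl i)) < (\<Sum>i<K. w Vc / K)"
      using K by (intro sum_strict_mono) (auto simp: not_le lessThan_empty_iff)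
    with calculation K show False by simp
  qed
  ultimately obtain i where i: "w Vc / K \<le> w (cl i)" by blast
  define V' where "V' = V - cl i"
  define L' where "L' = (\<lambda>v. L v - {c})"
  have clV: "cl i \<subseteq> Vc" by (auto simp: cl_def)
  have split: "(\<Sum>v\<in>V'. q ^ card (L' v)) = w (V - Vc) + (\<Sum>v\<in>Vc - cl i. q ^ card (L' v))"
  proof -
    have "V' = (V - Vc) \<union> (Vc - cl i)" using clV Vc by (auto simp: V'_def)
    moreover have "(\<Sum>v\<in>V - Vc. q ^ card (L' v)) = w (V - Vc)"
      unfolding w_def by (intro sum.cong) (auto simp: L'_def Vc_def)
    ultimately show ?thesis using fin by (subst (asm) sum.cong, simp_all) (subst sum.union_disjoint, auto)
  qed
  \<comment> \<open>Losing \<open>c\<close> multiplies the weight of \<open>Vc - cl i\<close> by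
    \<open>1/q\<close>. Removing \<open>cl i\<close> pays for this, as it held at least the share
    \<open>1/K = 1 - q\<close> of \<open>w Vc\<close>.\<close>
  have "q * (\<Sum>v\<in>Vc - cl i. q ^ card (L' v)) = w (Vc - cl i)"
    unfolding w_def sum_distrib_left
  proof (intro sum.cong refl)
    fix v assume "v \<in> Vc - cl i"
    then have "c \<in> L v" "finite (L v)" using finL Vc by (auto simp: Vc_def)
    then have "card (L v) = Suc (card (L' v))"
      unfolding L'_def by (metis card.remove)
    then show "q * q ^ card (L' v) = q ^ card (L v)" by simp
  qed
  also have "\<dots> = w Vc - w (cl i)"
    unfolding w_def using clV fin by (simp add: sum_diff)
  also have "\<dots> \<le> q * w Vc" using i by (simp add: q_def algebra_simps)
  finally have "(\<Sum>v\<in>Vc - cl i. q ^ card (L' v)) \<le> w Vc" using q by simp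
  then have "(\<Sum>v\<in>V'. q ^ card (L' v)) \<le> w (V - Vc) + w Vc" using split by simp
  also have "\<dots> = w V" unfolding w_def using Vc fin by (simp add: sum_diff)
  also have "\<dots> < 1" using insert.prems(4) by (simp add: w_def q_def)
  finally have less: "(\<Sum>v\<in>V'. q ^ card (L' v)) < 1" .
  have "\<exists>col. (\<forall>v\<in>V'. col v \<in> L' v) \<and>
          (\<forall>h\<in>H. h \<inter> V' \<noteq> {} \<longrightarrow> (\<exists>v\<in>h \<inter> V'. \<forall>w\<in>h \<inter> V'. w \<noteq> v \<longrightarrow> col w \<noteq> col v))"
    proof (rule insert.IH)
      show "finite V'" using fin by (simp add: V'_def)
      show "\<exists>f::'a \<Rightarrow> nat. (\<forall>a\<in>P. f a < K) \<and>
          (\<forall>h\<in>H. (\<forall>a\<in>h \<inter> P. \<forall>b\<in>h \<inter> P. f a = f b) \<longrightarrow> card (h \<inter> P) \<le> 1)"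
        if "P \<subseteq> V'" for P
        using that by (intro insert.prems(2)) (auto simp: V'_def)
      show "L' v \<subseteq> Cs" if "v \<in> V'" for v
        using that insert.prems(3)[of v] by (auto simp: V'_def L'_def)
    qed (use less in \<open>simp add: q_def\<close>)
  then obtain col where col: "\<And>v. v \<in> V' \<Longrightarrow> col v \<in> L' v"
    and cf: "\<And>h. h \<in> H \<Longrightarrow> h \<inter> V' \<noteq> {} \<Longrightarrow> \<exists>v\<in>h \<inter> V'. \<forall>w\<in>h \<inter> V'. w \<noteq> v \<longrightarrow> col w \<noteq> col v"
    by metis
  define col' where "col' = (\<lambda>v. if v \<in> cl i then c else col v)"
  \<comment> \<open>An edge meeting \<open>V'\<close> keeps its inductive witness, since
    \<open>c\<close> has left all lists there. Any other edge meets \<open>V\<close> inside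
    \<open>cl i\<close> only, is monochromatic under \<open>f\<close>, and so has a single
    vertex.\<close>
  have "\<exists>v\<in>h \<inter> V. \<forall>w\<in>h \<inter> V. w \<noteq> v \<longrightarrow> col' w \<noteq> col' v" if h: "h \<in> H" "h \<inter> V \<noteq> {}" for h
  proof (cases "h \<inter> V' = {}")
    case False
    then obtain v where v: "v \<in> h \<inter> V'" "\<forall>w\<in>h \<inter> V'. w \<noteq> v \<longrightarrow> col w \<noteq> col v"
      using cf[OF h(1)] by blast
    with col[of v] have "col v \<noteq> c" by (auto simp: L'_def)
    with v show ?thesis by (intro bexI[of _ v]) (auto simp: col'_def V'_def)
  next
    case True
    then have *: "h \<inter> V = h \<inter> cl i" "h \<inter> Vc = h \<inter> cl i" using clV Vc by (auto simp: V'_def)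
    then have "card (h \<inter> Vc) \<le> 1" using h by (intro mono) (auto simp: cl_def)
    then have "card (h \<inter> V) \<le> Suc 0" using * by simp
    then have "\<forall>a\<in>h \<inter> V. \<forall>b\<in>h \<inter> V. a = b"
      using fin by (subst (asm) card_le_Suc0_iff_eq) auto
    with h(2) show ?thesis by blast
  qed
  moreover have "\<forall>v\<in>V. col' v \<in> L v"
    using col by (auto simp: col'_def V'_def L'_def cl_def Vc_def)
  ultimately show ?case by blast
qed

text \<open>Colour \<open>P - {p}\<close> inductively and avoid for \<open>p\<close> the colours of
  its neighbours. A monochromatic edge through \<open>p\<close> has at most one other vertex by
  induction, so only traces \<open>{p, q}\<close> can go wrong. Deleting \<open>p\<close> shrinks
  edges and may create new pairs, whence the degree bound for every subset.\<close>

lemma degenerate_colorable: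
  fixes H :: "'a set set"
  assumes "finite P"
    and "\<And>Q. Q \<subseteq> P \<Longrightarrow> Q \<noteq> {} \<Longrightarrow>
          \<exists>p\<in>Q. card {q \<in> Q. q \<noteq> p \<and> (\<exists>h\<in>H. h \<inter> Q = {p, q})} < K"
  shows "\<exists>f::'a \<Rightarrow> nat. (\<forall>a\<in>P. f a < K) \<and>
          (\<forall>h\<in>H. (\<forall>a\<in>h \<inter> P. \<forall>b\<in>h \<inter> P. f a = f b) \<longrightarrow> card (h \<inter> P) \<le> 1)"
  using assms
proof (induction P rule: finite_psubset_induct)
  case (psubset P)
  show ?case
  proof (cases "P = {}")
    case False
    then obtain p where p: "p \<in> P" and "card {q \<in> P. q \<noteq> p \<and> (\<exists>h\<in>H. h \<inter> P = {p, q})} < K"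
      using psubset.prems[of P] by blast
    moreover define N where "N = {q \<in> P. q \<noteq> p \<and> (\<exists>h\<in>H. h \<inter> P = {p, q})}"
    ultimately have N: "card N < K" "finite N" using psubset.hyps by auto
    have "\<exists>f::'a \<Rightarrow> nat. (\<forall>a\<in>P - {p}. f a < K) \<and>
          (\<forall>h\<in>H. (\<forall>a\<in>h \<inter> (P - {p}). \<forall>b\<in>h \<inter> (P - {p}). f a = f b) \<longrightarrow> card (h \<inter> (P - {p})) \<le> 1)"
      using p by (intro psubset.IH psubset.prems) auto
    then obtain f :: "'a \<Rightarrow> nat" where f: "\<And>a. a \<in> P - {p} \<Longrightarrow> f a < K"
      and mono: "\<And>h. h \<in> H \<Longrightarrow> \<forall>a\<in>h \<inter> (P - {p}). \<forall>b\<in>h \<inter> (P - {p}). f a = f b \<Longrightarrow>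
                   card (h \<inter> (P - {p})) \<le> 1" by metis
    have "card (f ` N) < card {..<K}" using card_image_le[OF N(2), of f] N by simp
    then obtain i where i: "i < K" "i \<notin> f ` N"
      by (metis card_mono finite_imageI N(2) lessThan_iff not_le subsetI)
    define f' where "f' = f(p := i)"
    have "card (h \<inter> P) \<le> 1" if h: "h \<in> H" "\<forall>a\<in>h \<inter> P. \<forall>b\<in>h \<inter> P. f' a = f' b" for h
    proof (cases "p \<in> h")
      case False
      then have eq: "h \<inter> P = h \<inter> (P - {p})" by auto
      have "\<forall>a\<in>h \<inter> (P - {p}). \<forall>b\<in>h \<inter> (P - {p}). f a = f b"
      proof (intro ballI)
        fix a b assume ab: "a \<in> h \<inter> (P - {p})" "b \<in> h \<inter> (P - {p})"
        then have "f' a = f' b" using h(2) by blast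
        with ab show "f a = f b" by (simp add: f'_def)
      qed
      then show ?thesis by (subst eq) (rule mono[OF h(1)])
    next
      case True
      have "card (h \<inter> (P - {p})) \<le> Suc 0" unfolding One_nat_def[symmetric]
      proof (rule mono[OF h(1)], intro ballI)
        fix a b assume ab: "a \<in> h \<inter> (P - {p})" "b \<in> h \<inter> (P - {p})"
        then have "f' a = f' b" using h(2) by blast
        with ab show "f a = f b" by (simp add: f'_def)
      qed
      then have one: "\<forall>a\<in>h \<inter> (P - {p}). \<forall>b\<in>h \<inter> (P - {p}). a = b"
        using psubset.hyps by (subst (asm) card_le_Suc0_iff_eq) auto
      have "h \<inter> (P - {p}) = {}"
      proof (rule ccontr)
        assume "h \<inter> (P - {p}) \<noteq> {}"
        then obtain q where q: "q \<in> h" "q \<in> P" "q \<noteq> p" by auto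
        with one True p have "h \<inter> P = {p, q}" by auto
        with q h(1) have "q \<in> N" by (auto simp: N_def)
        moreover have "f' q = f' p" using h(2) q p True by blast
        ultimately show False using i q by (auto simp: f'_def)
      qed
      then have "h \<inter> P \<subseteq> {p}" by auto
      then show ?thesis using card_mono[of "{p}" "h \<inter> P"] by simp
    qed
    moreover have "f' a < K" if "a \<in> P" for a using that f i by (simp add: f'_def)
    ultimately show ?thesis by blast
  qed simp
qed

section \<open>Causality in null coordinates\<close>

text \<open>With spatial coordinates \<open>x, y\<close> and time \<open>t\<close>, the null coordinates are
  \<open>u = t + y\<close> and \<open>v = t - y\<close>, so the light cone is \<open>\<Delta>u \<Delta>v = (\<Delta>x)\<^sup>2\<close>.\<close>

datatype event = Event (xc: real) (uc: real) (vc: real)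

definition causal :: "event \<Rightarrow> event \<Rightarrow> bool" where
  "causal a b \<longleftrightarrow> uc a \<le> uc b \<and> vc a \<le> vc b \<and> (xc b - xc a)\<^sup>2 \<le> (uc b - uc a) * (vc b - vc a)"

text \<open>The interior of the future cone: a positive product also forces
  \<open>vc a < vc b\<close>.\<close>

definition chron :: "event \<Rightarrow> event \<Rightarrow> bool" where
  "chron a b \<longleftrightarrow> uc a < uc b \<and> (xc b - xc a)\<^sup>2 < (uc b - uc a) * (vc b - vc a)"

text \<open>The light ray from \<open>a\<close> with \<open>dx/du = s\<close>, at level \<open>u\<close>. These rays exhaust the
  future light cone of \<open>a\<close> except for the ray in direction \<open>v\<close>, along which \<open>u\<close> is constant.\<close>

definition ray :: "event \<Rightarrow> real \<Rightarrow> real \<Rightarrow> event" where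
  "ray a s u = Event (xc a + s * (u - uc a)) u (vc a + s\<^sup>2 * (u - uc a))"

definition slope :: "event \<Rightarrow> event \<Rightarrow> real" where
  "slope a z = (xc z - xc a) / (uc z - uc a)"

definition acausal :: "event set \<Rightarrow> bool" where
  "acausal P \<longleftrightarrow> (\<forall>a\<in>P. \<forall>b\<in>P. causal a b \<longrightarrow> a = b)"

section \<open>Light rays and the causal order\<close>

lemma ray_sel [simp]:
  "xc (ray a s u) = xc a + s * (u - uc a)" "uc (ray a s u) = u" "vc (ray a s u) = vc a + s\<^sup>2 * (u - uc a)"
  by (simp_all add: ray_def)

lemma ray_ray [simp]: "ray (ray a s m) s u = ray a s u"
  by (simp add: ray_def algebra_simps)

lemma causal_refl [simp]: "causal a a"
  by (simp add: causal_def)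

lemma causal_ray: "uc a \<le> u \<Longrightarrow> causal a (ray a s u)"
  by (auto simp: causal_def power2_eq_square)

text \<open>The cone is convex: the mixed term satisfies \<open>2BB' \<le> AC' + A'C\<close> by the
  inequality of arithmetic and geometric means.\<close>

lemma causal_trans:
  assumes "causal a b" "causal b c"
  shows "causal a c"
proof -
  define A B C A' B' C' where d: "A = uc b - uc a" "B = xc b - xc a" "C = vc b - vc a"
    "A' = uc c - uc b" "B' = xc c - xc b" "C' = vc c - vc b"
  have h: "A \<ge> 0" "C \<ge> 0" "B\<^sup>2 \<le> A * C" "A' \<ge> 0" "C' \<ge> 0" "B'\<^sup>2 \<le> A' * C'"
    using assms by (auto simp: causal_def d)
  have "(2 * (B * B'))\<^sup>2 = 4 * (B\<^sup>2 * B'\<^sup>2)" by (simp add: power_mult_distrib)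
  also have "\<dots> \<le> 4 * ((A * C) * (A' * C'))" using h by (intro mult_left_mono mult_mono) auto
  also have "\<dots> \<le> (A * C' + A' * C)\<^sup>2"
    using zero_le_power2[of "A * C' - A' * C"] by (simp add: power2_eq_square algebra_simps)
  finally have "2 * (B * B') \<le> A * C' + A' * C"
    by (rule power2_le_imp_le) (use h in simp)
  then have "(B + B')\<^sup>2 \<le> (A + A') * (C + C')"
    using h by (simp add: power2_eq_square algebra_simps)
  then show ?thesis using h by (simp add: causal_def d)
qed

lemma causal_iff_not_spacelike:
  "causal a b \<or> causal b a \<longleftrightarrow> (xc b - xc a)\<^sup>2 \<le> (uc b - uc a) * (vc b - vc a)"
proof
  assume le: "(xc b - xc a)\<^sup>2 \<le> (uc b - uc a) * (vc b - vc a)"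
  then have "0 \<le> (uc b - uc a) * (vc b - vc a)" by (rule order_trans[OF zero_le_power2])
  then have "uc a \<le> uc b \<and> vc a \<le> vc b \<or> uc b \<le> uc a \<and> vc b \<le> vc a"
    by (auto simp: zero_le_mult_iff)
  with le show "causal a b \<or> causal b a"
    by (auto simp: causal_def power2_eq_square algebra_simps)
qed (auto simp: causal_def power2_eq_square algebra_simps)

lemma chron_causal: "chron a b \<Longrightarrow> causal a b"
  using zero_le_mult_iff[of "uc b - uc a" "vc b - vc a"]
  by (auto simp: chron_def causal_def dest: order_le_less_trans[OF zero_le_power2] simp: zero_less_mult_iff)

text \<open>A causal step followed by a light ray ends in the interior of the cone unless both run
  along one light ray. The interval at the end is the interval at \<open>y\<close> plus
  \<open>t\<close> times a quadratic in \<open>s\<close>, and \<open>A\<close> times that quadratic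
  is \<open>(B - s * A)^2 + (A * C - B^2)\<close>.\<close>

lemma chron_ray:
  assumes "causal r y" "uc y < u"
    and strict: "xc y - xc r \<noteq> s * (uc y - uc r) \<or> chron r y \<or> uc r = uc y \<and> vc r < vc y"
  shows "chron r (ray y s u)"
proof -
  define A B C t where d: "A = uc y - uc r" "B = xc y - xc r" "C = vc y - vc r" "t = u - uc y"
  have h: "A \<ge> 0" "C \<ge> 0" "B\<^sup>2 \<le> A * C" "t > 0" using assms by (auto simp: causal_def d)
  have s: "B \<noteq> s * A \<or> B\<^sup>2 < A * C \<or> A = 0 \<and> C > 0" using strict by (auto simp: chron_def d)
  have id: "(A + t) * (C + s\<^sup>2 * t) - (B + s * t)\<^sup>2 = (A * C - B\<^sup>2) + t * (A * s\<^sup>2 - 2 * B * s + C)"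
    by (simp add: power2_eq_square algebra_simps)
  have "0 < (A * C - B\<^sup>2) + t * (A * s\<^sup>2 - 2 * B * s + C)"
  proof (cases "A = 0")
    case True
    with h have "B = 0" by simp
    with True s h show ?thesis by auto
  next
    case False
    with h have A: "A > 0" by simp
    have *: "A * (A * s\<^sup>2 - 2 * B * s + C) = (B - s * A)\<^sup>2 + (A * C - B\<^sup>2)"
      by (simp add: power2_eq_square algebra_simps)
    then have "0 \<le> A * (A * s\<^sup>2 - 2 * B * s + C)" using h by simp
    then have ge: "0 \<le> A * s\<^sup>2 - 2 * B * s + C" using A by (simp add: zero_le_mult_iff)
    show ?thesis
    proof (cases "B\<^sup>2 < A * C")
      case True
      with ge h show ?thesis by (intro add_pos_nonneg) auto
    next
      case False
      with s A have "0 < (B - s * A)\<^sup>2" by auto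
      then have "0 < (B - s * A)\<^sup>2 + (A * C - B\<^sup>2)" using h by linarith
      then have "0 < A * (A * s\<^sup>2 - 2 * B * s + C)" by (simp only: *)
      with A h show ?thesis by (intro add_nonneg_pos) (auto simp: zero_less_mult_iff)
    qed
  qed
  then have "(B + s * t)\<^sup>2 < (A + t) * (C + s\<^sup>2 * t)" using id by simp
  moreover have "uc r < u" using assms by (auto simp: causal_def)
  ultimately show ?thesis by (simp add: chron_def d algebra_simps)
qed

lemma ray_slope:
  assumes "uc a < uc z" "(xc z - xc a)\<^sup>2 = (uc z - uc a) * (vc z - vc a)"
  shows "ray a (slope a z) (uc z) = z"
proof (rule event.expand, intro conjI)
  show "vc (ray a (slope a z) (uc z)) = vc z"
    using assms by (simp add: slope_def power_divide) (simp add: power2_eq_square)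
qed (use assms in \<open>auto simp: slope_def\<close>)

lemma not_chron_ray: "\<not> chron a (ray a s u)"
  by (auto simp: chron_def power2_eq_square)

text \<open>At a crossing in the \<open>(x,u)\<close> plane the ray with smaller \<open>v\<close>
  lies causally before the other. Since the slopes differ, the other ray then runs into the interior
  of the cone of \<open>b\<close>, by \<open>chron_ray\<close>.\<close>

lemma rays_meet_aux:
  assumes "\<not> causal a b" "uc a \<le> m" "uc b \<le> m" "m < u" "s \<noteq> t"
    and meet: "xc a + s * (m - uc a) = xc b + t * (m - uc b)"
    and le: "vc (ray b t m) \<le> vc (ray a s m)"
  shows "chron b (ray a s u)"
proof -
  let ?y = "ray a s m"
  have "causal (ray b t m) ?y" using meet le by (simp add: causal_def)
  with causal_ray[OF assms(3)] have b: "causal b ?y" by (rule causal_trans)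
  have "chron b (ray ?y s u)"
  proof (rule chron_ray[OF b])
    have "vc b < vc ?y" if "uc b = m"
    proof (rule ccontr)
      assume "\<not> vc b < vc ?y"
      with that le meet have "?y = b" by (intro event.expand) auto
      with causal_ray[OF assms(2), of s] assms(1) show False by simp
    qed
    then show "xc ?y - xc b \<noteq> s * (uc ?y - uc b) \<or> chron b ?y \<or> uc b = uc ?y \<and> vc b < vc ?y"
      using meet \<open>s \<noteq> t\<close> by auto
  qed (use assms in auto)
  then show ?thesis by simp
qed

lemma rays_meet:
  assumes "\<not> causal a b" "\<not> causal b a" "uc a \<le> m" "uc b \<le> m" "m < u" "m < u'" "s \<noteq> t"
    and "xc a + s * (m - uc a) = xc b + t * (m - uc b)"
  shows "chron a (ray b t u') \<or> chron b (ray a s u)"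
proof (cases "vc (ray b t m) \<le> vc (ray a s m)")
  case True
  then show ?thesis using assms by (intro disjI2 rays_meet_aux[of a b m])
next
  case False
  then show ?thesis using assms by (intro disjI1 rays_meet_aux[of b a m]) auto
qed

section \<open>Wedges and births inside cells\<close>

text \<open>The value of \<open>v\<close> at which the line in direction \<open>v\<close> through \<open>w\<close> enters the future
  of \<open>a\<close>; meaningful only for \<open>uc a < uc w\<close>. In the \<open>(x,u)\<close> plane the cell of \<open>b\<close> is where
  its height is least, and \<open>w\<close> is a child of \<open>b\<close> if it is born inside that cell.\<close>

definition height :: "event \<Rightarrow> event \<Rightarrow> real" where
  "height a w = vc a + (xc w - xc a)\<^sup>2 / (uc w - uc a)"

definition child_of :: "event set \<Rightarrow> event \<Rightarrow> event \<Rightarrow> bool" where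
  "child_of P b w \<longleftrightarrow> b \<in> P \<and> w \<in> P \<and> uc b < uc w \<and>
     (\<forall>a\<in>P. a \<noteq> b \<longrightarrow> uc a < uc w \<longrightarrow> height b w < height a w)"

text \<open>Two points of the cell of \<open>b\<close> span a wedge with apex \<open>b\<close> whose sides no other light ray
  can cross, by \<open>rays_meet\<close>. The leg from \<open>r\<close> enters it, so \<open>r\<close> lies inside, and the lowest event
  of the wedge can only be born in the cell of \<open>b\<close>.\<close>

lemma wedge_child:
  assumes "finite P" "acausal P" "b \<in> P" "r \<in> P" "r \<noteq> b"
    and u: "uc b < u1" "uc r < u1" "u1 \<le> u2"
    and empty: "\<And>a. a \<in> P \<Longrightarrow> \<not> chron a (ray b s1 u1)" "\<And>a. a \<in> P \<Longrightarrow> \<not> chron a (ray b s2 u2)"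
    and r: "ray r t u1 = ray b s1 u1" and side: "(t - s1) * (s2 - s1) < 0"
  shows "\<exists>w. child_of P b w \<and> (slope b w - s1) * (slope b w - s2) < 0"
proof -
  \<comment> \<open>Above level \<open>uc b\<close> this is negative exactly strictly between the
    two rays from \<open>b\<close>; at that level it is a square.\<close>
  define g where "g = (\<lambda>u x. (x - (xc b + s1 * (u - uc b))) * (x - (xc b + s2 * (u - uc b))))"
  define W where "W = {w \<in> P. uc b < uc w \<and> uc w < u1 \<and> g (uc w) (xc w) < 0}"
  \<comment> \<open>An event not born in the wedge gets inside only across a side, located by the
    intermediate value theorem. By \<open>rays_meet\<close>, either \<open>a\<close> chronologically
    precedes a later point of that side, which \<open>empty\<close> forbids, or \<open>b\<close>
    precedes the ray of \<open>a\<close> at \<open>u\<close>.\<close>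
  have enter: "chron b (ray a \<sigma> u)"
    if a: "a \<in> P" "a \<noteq> b" "a \<notin> W" and u': "uc a < u" "uc b < u" "u \<le> u1"
      and neg: "g u (xc a + \<sigma> * (u - uc a)) < 0" for a \<sigma> u
  proof -
    define G where "G = (\<lambda>u. g u (xc a + \<sigma> * (u - uc a)))"
    define m where "m = max (uc a) (uc b)"
    have m: "uc a \<le> m" "uc b \<le> m" "m < u" using u' by (auto simp: m_def)
    have "0 \<le> G m"
    proof (cases "uc a \<le> uc b")
      case True
      then show ?thesis by (simp add: G_def g_def m_def max_def)
    next
      case False
      then show ?thesis using a u' by (auto simp: G_def m_def W_def)
    qed
    moreover have "continuous_on {m..u} G" unfolding G_def g_def by (intro continuous_intros)
    ultimately obtain k where k: "m \<le> k" "k \<le> u" "G k = 0"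
      using neg IVT2'[of G u 0 m] m by (auto simp: G_def)
    then have "k < u" using neg by (auto simp: G_def order.order_iff_strict)
    have hit: False if "s \<in> {s1, s2}" "xc a + \<sigma> * (k - uc a) = xc b + s * (k - uc b)"
      "\<And>c. c \<in> P \<Longrightarrow> \<not> chron c (ray b s v)" "k < v" "\<not> chron b (ray a \<sigma> u)" for s v
    proof -
      have "\<sigma> \<noteq> s"
      proof
        assume "\<sigma> = s"
        then have "xc a + \<sigma> * (u - uc a) = xc b + s * (u - uc b)"
          using that(2) by (simp add: algebra_simps)
        then show False using neg that(1) by (auto simp: g_def)
      qed
      moreover have "\<not> causal a b" "\<not> causal b a"
        using assms(2,3) a by (auto simp: acausal_def)
      ultimately have "chron a (ray b s v) \<or> chron b (ray a \<sigma> u)"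
        using that(2,4) m k \<open>k < u\<close> by (intro rays_meet[of a b k]) auto
      with that a show False by blast
    qed
    from k(3) have "xc a + \<sigma> * (k - uc a) = xc b + s1 * (k - uc b) \<or>
                    xc a + \<sigma> * (k - uc a) = xc b + s2 * (k - uc b)"
      by (auto simp: G_def g_def)
    then show ?thesis
      using hit[of s1 u1] hit[of s2 u2] empty u u' \<open>k < u\<close> by fastforce
  qed
  have "r \<in> W"
  proof (rule ccontr)
    assume "r \<notin> W"
    \<comment> \<open>By \<open>side\<close>, the leg of \<open>r\<close> runs inside the wedge just
      below \<open>u1\<close>: at level \<open>u1 - e\<close> the value of \<open>g\<close> is
      \<open>e * (e * K - D)\<close>. If \<open>r\<close> were born outside, \<open>enter\<close>
      would put this point, and then \<open>ray r t u1\<close>, into the interior of the cone of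
      \<open>b\<close>, but that endpoint lies on the cone itself.\<close>
    define D where "D = - ((t - s1) * (s2 - s1)) * (u1 - uc b)"
    define K where "K = (t - s1) * (t - s2)"
    have D: "D > 0" unfolding D_def using side u by (intro mult_pos_pos) auto
    define A where "A = D / (\<bar>K\<bar> + 1)"
    define e where "e = min ((u1 - max (uc r) (uc b)) / 2) (A / 2)"
    have "0 < A" "max (uc r) (uc b) < u1" using D u by (auto simp: A_def)
    then have e: "0 < e" "e < u1 - uc r" "e < u1 - uc b" "e < A"
      by (auto simp: e_def min_def max_def)
    from e(4) have "e * (\<bar>K\<bar> + 1) < D" by (simp add: A_def pos_less_divide_eq)
    moreover have "e * K \<le> e * (\<bar>K\<bar> + 1)" using e by (intro mult_left_mono) auto
    ultimately have "e * K < D" by linarith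
    then have "e * (e * K - D) < 0" using e by (intro mult_pos_neg) auto
    moreover have "g (u1 - e) (xc r + t * (u1 - e - uc r)) = e * (e * K - D)"
    proof -
      have "xc r + t * (u1 - e - uc r) = xc b + s1 * (u1 - uc b) - t * e"
        using arg_cong[OF r, of xc] by (simp add: algebra_simps)
      show ?thesis unfolding g_def K_def D_def \<open>xc r + _ = _\<close> by (simp add: algebra_simps)
    qed
    ultimately have ch: "chron b (ray r t (u1 - e))"
      using \<open>r \<notin> W\<close> assms(4,5) e by (intro enter) auto
    have "chron b (ray (ray r t (u1 - e)) t u1)"
      by (rule chron_ray[OF chron_causal[OF ch]]) (use ch e in auto)
    then show False using r not_chron_ray by simp
  qed
  then have "finite W" "W \<noteq> {}" using assms(1) by (auto simp: W_def)
  then obtain w where w: "w \<in> W" and least: "\<And>a. a \<in> W \<Longrightarrow> uc w \<le> uc a"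
    using finite_imageI[of W uc] by (metis arg_min_if_finite(1) arg_min_least)
  \<comment> \<open>No event of a level below \<open>uc w\<close> is born in the wedge, so
    \<open>enter\<close> applies to the ray from \<open>a\<close> aimed at the \<open>(x,u)\<close>
    position of \<open>w\<close>.\<close>
  have "height b w < height a w" if a: "a \<in> P" "a \<noteq> b" "uc a < uc w" for a
  proof -
    have "xc a + slope a w * (uc w - uc a) = xc w" using a by (simp add: slope_def)
    then have "chron b (ray a (slope a w) (uc w))"
      using a w least[of a] by (intro enter) (auto simp: W_def)
    then have "(xc w - xc b)\<^sup>2 < (uc w - uc b) * (height a w - vc b)"
      using a by (simp add: chron_def slope_def height_def power_divide)
        (simp add: power2_eq_square)
    then show ?thesis using w by (simp add: height_def W_def field_simps)
  qed
  then have "child_of P b w" using w assms(3) by (auto simp: child_of_def W_def)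
  moreover have "g (uc w) (xc w) = (uc w - uc b)\<^sup>2 * ((slope b w - s1) * (slope b w - s2))"
  proof -
    have "xc w - (xc b + s * (uc w - uc b)) = (uc w - uc b) * (slope b w - s)" for s
    proof -
      have "(uc w - uc b) * slope b w = xc w - xc b" using w by (simp add: slope_def W_def)
      then show ?thesis by (simp add: algebra_simps)
    qed
    then show ?thesis unfolding g_def by (simp add: power2_eq_square)
  qed
  then have "(slope b w - s1) * (slope b w - s2) < 0"
    using w by (auto simp: W_def mult_less_0_iff)
  ultimately show ?thesis by blast
qed

section \<open>Ends of cells and their number\<close>

text \<open>The cell of \<open>b\<close> ends at \<open>z\<close>, squeezed between those of \<open>p\<close> (left) and \<open>q\<close> (right). Among
  all events with \<open>z\<close> on their cone, \<open>p\<close> and \<open>q\<close> have the extreme slopes, so \<open>z\<close> determines them.\<close>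

definition top_of :: "event set \<Rightarrow> event \<Rightarrow> event \<Rightarrow> event \<Rightarrow> event \<Rightarrow> bool" where
  "top_of P p b q z \<longleftrightarrow> {p, b, q} \<subseteq> P \<and> (\<forall>a\<in>P. \<not> chron a z) \<and>
     (\<forall>a\<in>{p, b, q}. uc a < uc z \<and> ray a (slope a z) (uc z) = z) \<and>
     slope q z < slope b z \<and> slope b z < slope p z \<and>
     (\<forall>r\<in>P. causal r z \<longrightarrow> r = p \<or> r = q \<or> slope q z < slope r z \<and> slope r z < slope p z)"

text \<open>The wedge between the two slopes lies on the side of \<open>q\<close> at
  \<open>z\<close> and on the side of \<open>p'\<close> at \<open>z'\<close>. Whichever end has the
  lower level supplies the entering leg for \<open>wedge_child\<close>.\<close>

lemma child_between_tops:
  assumes "finite P" "acausal P" and z: "top_of P p b q z" "top_of P p' b q' z'"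
    and less: "slope b z < slope b z'"
  shows "\<exists>w. child_of P b w \<and> slope b z < slope b w \<and> slope b w < slope b z'"
proof (cases "uc z \<le> uc z'")
  case True
  have "\<exists>w. child_of P b w \<and> (slope b w - slope b z) * (slope b w - slope b z') < 0"
    using assms(1,2)
  proof (rule wedge_child[of P b q "uc z" "uc z'" "slope b z" "slope b z'" "slope q z"])
    show "(slope q z - slope b z) * (slope b z' - slope b z) < 0"
      using z less by (auto simp: top_of_def mult_less_0_iff)
  qed (use True z in \<open>auto simp: top_of_def\<close>)
  then show ?thesis using less by (auto simp: mult_less_0_iff)
next
  case False
  have "\<exists>w. child_of P b w \<and> (slope b w - slope b z') * (slope b w - slope b z) < 0"
    using assms(1,2)
  proof (rule wedge_child[of P b p' "uc z'" "uc z" "slope b z'" "slope b z" "slope p' z'"])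
    show "(slope p' z' - slope b z') * (slope b z - slope b z') < 0"
      using z less by (auto simp: top_of_def mult_less_0_iff)
  qed (use False z in \<open>auto simp: top_of_def\<close>)
  then show ?thesis using less by (auto simp: mult_less_0_iff)
qed

text \<open>\<open>p\<close> reaches \<open>z\<close> with another slope than \<open>b\<close>, so
  the ray of \<open>b\<close> beyond \<open>z\<close> lies in the interior of the cone of
  \<open>p\<close>, where no top can be.\<close>

lemma top_of_level_le:
  assumes z: "top_of P p b q z" "top_of P p' b q' z'" and eq: "slope b z = slope b z'"
  shows "uc z' \<le> uc z"
proof (rule ccontr)
  assume less: "\<not> ?thesis"
  have p: "uc p < uc z" "ray p (slope p z) (uc z) = z" "slope b z < slope p z"
    and b: "ray b (slope b z) (uc z) = z" "ray b (slope b z) (uc z') = z'"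
    using z eq by (auto simp: top_of_def)
  have "causal p z" using causal_ray[of p "uc z" "slope p z"] p by simp
  then have "chron p (ray z (slope b z) (uc z'))"
  proof (rule chron_ray)
    have "xc z - xc p = slope p z * (uc z - uc p)" using p by (simp add: slope_def)
    then show "xc z - xc p \<noteq> slope b z * (uc z - uc p) \<or> chron p z \<or> uc p = uc z \<and> vc p < vc z"
      using p by auto
  qed (use less in simp)
  also have "ray z (slope b z) (uc z') = z'" by (metis b ray_ray)
  finally show False using z by (auto simp: top_of_def)
qed

lemma top_of_unique:
  assumes z: "top_of P p b q z" "top_of P p' b q' z'" and eq: "slope b z = slope b z'"
  shows "p = p' \<and> q = q'"
proof -
  have "uc z = uc z'"
    using top_of_level_le[OF z eq] top_of_level_le[OF z(2,1) eq[symmetric]] by simp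
  then have zz: "z' = z" using z eq by (metis insertCI top_of_def)
  have c: "causal a z" if "a \<in> {p, q, p', q'}" for a
    using that z causal_ray[of a "uc z" "slope a z"] unfolding zz by (auto simp: top_of_def)
  have 1: "p' = p \<or> p' = q \<or> slope q z < slope p' z \<and> slope p' z < slope p z"
    "q' = p \<or> q' = q \<or> slope q z < slope q' z \<and> slope q' z < slope p z"
    "slope q z < slope p z"
    using z(1) z(2) c by (auto simp: top_of_def)
  have 2: "p = p' \<or> p = q' \<or> slope q' z < slope p z \<and> slope p z < slope p' z"
    "q = p' \<or> q = q' \<or> slope q' z < slope q z \<and> slope q z < slope p' z"
    "slope q' z < slope p' z"
    using z(1) z(2) c unfolding zz by (auto simp: top_of_def)
  from 1 2 show ?thesis by (smt (verit))
qed

lemma card_le_Suc_interleaved: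
  fixes A B :: "'a::linorder set"
  assumes "finite A" "finite B" "\<And>x y. x \<in> A \<Longrightarrow> y \<in> A \<Longrightarrow> x < y \<Longrightarrow> \<exists>w\<in>B. x < w \<and> w < y"
  shows "card A \<le> Suc (card B)"
  using assms
proof (induction A arbitrary: B rule: finite_linorder_max_induct)
  case (insert x A)
  show ?case
  proof (cases "A = {}")
    case False
    define y where "y = Max A"
    have y: "y \<in> A" "\<And>a. a \<in> A \<Longrightarrow> a \<le> y" using False insert.hyps by (auto simp: y_def)
    then obtain w where w: "w \<in> B" "y < w" "w < x" using insert.prems(2)[of y x] insert.hyps by auto
    have "card A \<le> Suc (card (B - {w}))"
    proof (rule insert.IH)
      fix a b assume ab: "a \<in> A" "b \<in> A" "a < b"
      then obtain v where "v \<in> B" "a < v" "v < b" using insert.prems(2)[of a b] by auto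
      then show "\<exists>w\<in>B - {w}. a < w \<and> w < b" using w y(2)[OF ab(2)] by fastforce
    qed (use insert.prems in auto)
    also have "\<dots> = card B" using w insert.prems(1) by (metis card.remove)
    finally show ?thesis using insert.hyps by auto
  qed simp
qed simp

text \<open>The tops of a cell \<open>b\<close> have distinct slopes, separated by slopes of
  children of \<open>b\<close>, so there are at most one more of them than children. Strict
  minimality of the height gives each event at most one parent, so summing over \<open>b\<close>
  yields \<open>2 * card P\<close>.\<close>

lemma card_tops:
  assumes P: "finite P" "acausal P"
    and E: "\<And>p q. (p, q) \<in> E \<Longrightarrow> \<exists>b z. top_of P p b q z"
  shows "card E \<le> 2 * card P"
proof -
  have E_sub: "E \<subseteq> P \<times> P" using E by (fastforce simp: top_of_def)
  have "\<forall>e\<in>E. \<exists>bz. top_of P (fst e) (fst bz) (snd e) (snd bz)" using E by fastforce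
  then obtain F where F: "\<And>e. e \<in> E \<Longrightarrow> top_of P (fst e) (fst (F e)) (snd e) (snd (F e))"
    by metis
  define T where "T = (\<lambda>b. {e \<in> E. fst (F e) = b})"
  define ch where "ch = (\<lambda>b. {w. child_of P b w})"
  have fin: "finite E" "\<And>b. finite (T b)" "\<And>b. finite (ch b)"
    using finite_subset[OF E_sub] P finite_subset[of "ch _" P]
    by (auto simp: T_def ch_def child_of_def)
  have T: "card (T b) \<le> Suc (card (ch b))" for b
  proof -
    define S where "S = (\<lambda>e. slope b (snd (F e)))"
    have "inj_on S (T b)"
    proof (rule inj_onI)
      fix e e' assume e: "e \<in> T b" "e' \<in> T b" "S e = S e'"
      then have "top_of P (fst e) b (snd e) (snd (F e))" "top_of P (fst e') b (snd e') (snd (F e'))"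
        using F[of e] F[of e'] by (simp_all add: T_def)
      then have "fst e = fst e' \<and> snd e = snd e'" using e(3) unfolding S_def by (rule top_of_unique)
      then show "e = e'" by (simp add: prod_eq_iff)
    qed
    then have "card (T b) = card (S ` T b)" by (simp add: card_image)
    also have "\<dots> \<le> Suc (card (slope b ` ch b))"
    proof (rule card_le_Suc_interleaved)
      fix x y assume "x \<in> S ` T b" "y \<in> S ` T b" "x < y"
      then obtain e e' where e: "e \<in> T b" "e' \<in> T b" "x = S e" "y = S e'" "S e < S e'" by auto
      then have "top_of P (fst e) b (snd e) (snd (F e))" "top_of P (fst e') b (snd e') (snd (F e'))"
        using F[of e] F[of e'] by (simp_all add: T_def)
      from child_between_tops[OF P this] obtain w
        where "child_of P b w" "x < slope b w" "slope b w < y" using e by (auto simp: S_def)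
      then show "\<exists>w\<in>slope b ` ch b. x < w \<and> w < y" by (auto simp: ch_def)
    qed (use fin in auto)
    also have "\<dots> \<le> Suc (card (ch b))" using fin by (simp add: card_image_le)
    finally show ?thesis .
  qed
  have "E = (\<Union>b\<in>P. T b)" using F by (auto simp: T_def top_of_def)
  then have "card E \<le> (\<Sum>b\<in>P. card (T b))" using P by (metis card_UN_le)
  also have "\<dots> \<le> (\<Sum>b\<in>P. Suc (card (ch b)))" using T by (intro sum_mono)
  also have "\<dots> = card P + (\<Sum>b\<in>P. card (ch b))" by (simp add: sum_Suc)
  also have "(\<Sum>b\<in>P. card (ch b)) = card (\<Union>b\<in>P. ch b)"
  proof (rule card_UN_disjoint[symmetric])
    show "\<forall>i\<in>P. \<forall>j\<in>P. i \<noteq> j \<longrightarrow> ch i \<inter> ch j = {}"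
      by (force simp: ch_def child_of_def)
  qed (use P fin in auto)
  also have "\<dots> \<le> card P" using P by (intro card_mono) (auto simp: ch_def child_of_def)
  finally show ?thesis by simp
qed

section \<open>Where a light ray enters the future of another event\<close>

text \<open>The point of the ray from \<open>p\<close> with slope \<open>s\<close> at level \<open>uc p + \<tau>\<close> lies in the future of
  \<open>r\<close> iff \<open>\<tau> * reach p r s \<ge> 1\<close>. As a function of \<open>s\<close> this is a quadratic polynomial.\<close>

definition reach :: "event \<Rightarrow> event \<Rightarrow> real \<Rightarrow> real" where
  "reach p r s = ((uc p - uc r) * s\<^sup>2 - 2 * (xc p - xc r) * s + (vc p - vc r)) /
     ((xc p - xc r)\<^sup>2 - (uc p - uc r) * (vc p - vc r))"

lemma spacelike_pos:
  assumes "\<not> causal p r" "\<not> causal r p"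
  shows "0 < (xc p - xc r)\<^sup>2 - (uc p - uc r) * (vc p - vc r)"
  using assms causal_iff_not_spacelike[of r p] by auto

lemma reach_interval:
  fixes s :: real
  assumes pr: "\<not> causal p r" "\<not> causal r p" and "0 < \<tau>"
  defines "z \<equiv> ray p s (uc p + \<tau>)"
  shows "(uc z - uc r) * (vc z - vc r) - (xc z - xc r)\<^sup>2 =
    (\<tau> * reach p r s - 1) * ((xc p - xc r)\<^sup>2 - (uc p - uc r) * (vc p - vc r))"
proof -
  define N Q where d: "N = (xc p - xc r)\<^sup>2 - (uc p - uc r) * (vc p - vc r)"
    "Q = (uc p - uc r) * s\<^sup>2 - 2 * (xc p - xc r) * s + (vc p - vc r)"
  have "reach p r s * N = Q" using spacelike_pos[OF pr] by (simp add: reach_def d)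
  then have "(\<tau> * reach p r s - 1) * N = \<tau> * Q - N" by (simp add: algebra_simps)
  then show ?thesis by (simp add: z_def d power2_eq_square algebra_simps)
qed

lemma causal_ray_iff:
  assumes pr: "\<not> causal p r" "\<not> causal r p" and "0 < \<tau>"
  shows "causal r (ray p s (uc p + \<tau>)) \<longleftrightarrow> 1 \<le> \<tau> * reach p r s" (is "causal r ?z \<longleftrightarrow> _")
proof -
  have "causal p ?z" using assms by (intro causal_ray) simp
  then have "\<not> causal ?z r" using pr causal_trans by blast
  then have "causal r ?z \<longleftrightarrow> 0 \<le> (uc ?z - uc r) * (vc ?z - vc r) - (xc ?z - xc r)\<^sup>2"
    using causal_iff_not_spacelike[of r ?z] by auto
  then show ?thesis
    unfolding reach_interval[OF assms] using spacelike_pos[OF pr] by (simp add: zero_le_mult_iff)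
qed

lemma chron_ray_imp:
  assumes pr: "\<not> causal p r" "\<not> causal r p" and "0 < \<tau>"
    and c: "chron r (ray p s (uc p + \<tau>))" (is "chron r ?z")
  shows "1 < \<tau> * reach p r s"
proof -
  have "0 < (uc ?z - uc r) * (vc ?z - vc r) - (xc ?z - xc r)\<^sup>2" using c by (simp add: chron_def)
  then show ?thesis
    unfolding reach_interval[OF assms(1-3)] using spacelike_pos[OF pr] by (simp add: zero_less_mult_iff)
qed

lemma slope_ray [simp]: "uc a < u \<Longrightarrow> slope a (ray a s u) = s"
  by (simp add: slope_def)

text \<open>Hypothesis \<open>D\<close> says that \<open>reach p r\<close> increases at
  \<open>s\<close>; the last conclusion ties the arrival slope at \<open>z\<close> to that
  derivative. From \<open>d^2 = U * Q + N\<close> and \<open>\<tau> * Q = N\<close> follows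
  \<open>\<tau> * d^2 = N * (U + \<tau>)\<close>, which gives both \<open>U + \<tau> > 0\<close> and
  the slope.\<close>

lemma slope_on_cone:
  fixes s :: real
  assumes pr: "\<not> causal p r" "\<not> causal r p" and t: "0 < \<tau>" "\<tau> * reach p r s = 1"
    and D: "0 < (uc p - uc r) * s - (xc p - xc r)"
  defines "z \<equiv> ray p s (uc p + \<tau>)"
  shows "uc r < uc z" "ray r (slope r z) (uc z) = z"
    "slope r z = s - ((xc p - xc r)\<^sup>2 - (uc p - uc r) * (vc p - vc r)) /
                    (\<tau> * ((uc p - uc r) * s - (xc p - xc r)))"
proof -
  define U X V where UXV: "U = uc p - uc r" "X = xc p - xc r" "V = vc p - vc r"
  define N Q d where d: "N = X\<^sup>2 - U * V" "Q = U * s\<^sup>2 - 2 * X * s + V" "d = U * s - X"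
  have N: "0 < N" using spacelike_pos[OF pr] by (simp add: d UXV)
  have "reach p r s = Q / N" by (simp add: reach_def d UXV)
  then have "\<tau> * Q = (\<tau> * reach p r s) * N" using N by simp
  then have Q: "\<tau> * Q = N" using t by simp
  have "d\<^sup>2 = U * Q + N" by (simp add: d power2_eq_square algebra_simps)
  then have d2: "\<tau> * d\<^sup>2 = N * (U + \<tau>)" by (simp add: Q[symmetric] algebra_simps)
  have dpos: "0 < d" using D by (simp add: d UXV)
  have "0 < N * (U + \<tau>)" using dpos t unfolding d2[symmetric] by simp
  then have Ut: "0 < U + \<tau>" using N by (simp add: zero_less_mult_iff)
  then show u: "uc r < uc z" by (simp add: z_def UXV)
  have "(uc z - uc r) * (vc z - vc r) - (xc z - xc r)\<^sup>2 = 0"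
    unfolding z_def using reach_interval[OF pr t(1)] t by simp
  then show "ray r (slope r z) (uc z) = z" using u by (intro ray_slope) auto
  have "slope r z = (X + s * \<tau>) / (U + \<tau>)" by (simp add: slope_def z_def UXV algebra_simps)
  also have "\<dots> = s - d / (U + \<tau>)" using Ut by (simp add: d field_simps)
  also have "d / (U + \<tau>) = N / (\<tau> * d)"
    using Ut dpos t d2 by (simp add: frac_eq_eq power2_eq_square algebra_simps)
  finally show "slope r z = s - ((xc p - xc r)\<^sup>2 - (uc p - uc r) * (vc p - vc r)) /
                    (\<tau> * ((uc p - uc r) * s - (xc p - xc r)))"
    by (simp add: d UXV)
qed

text \<open>Used to see that distinct events of an acausal set arrive at a common point with
  distinct slopes.\<close>

lemma ray_eq_causal:
  assumes "ray a t u = ray b t u"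
  shows "causal a b \<or> causal b a"
proof -
  have x: "xc a - xc b = t * (uc a - uc b)" and v: "vc a - vc b = t\<^sup>2 * (uc a - uc b)"
    using arg_cong[OF assms, of xc] arg_cong[OF assms, of vc] by (simp_all add: algebra_simps)
  have "(xc b - xc a)\<^sup>2 = (xc a - xc b)\<^sup>2" by (simp add: power2_commute)
  also have "\<dots> = (uc a - uc b) * (vc a - vc b)" unfolding x v by (simp add: power2_eq_square)
  also have "\<dots> = (uc b - uc a) * (vc b - vc a)" by (simp add: algebra_simps)
  finally show ?thesis using causal_iff_not_spacelike[of a b] by simp
qed

lemma DERIV_reach:
  "(reach p r has_real_derivative
     2 * ((uc p - uc r) * s - (xc p - xc r)) / ((xc p - xc r)\<^sup>2 - (uc p - uc r) * (vc p - vc r))) (at s)"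
  unfolding reach_def
  by (rule DERIV_cdivide) (auto intro!: derivative_eq_intros simp: algebra_simps)

lemma continuous_on_reach [continuous_intros]: "continuous_on A (reach p r)"
  by (meson DERIV_isCont DERIV_reach continuous_at_imp_continuous_on)

section \<open>Walking along the boundary between two cells\<close>

text \<open>Increasing \<open>s\<close> moves down along the boundary between the cells of \<open>p\<close> and \<open>q\<close>, until
  some \<open>b\<close> blocks the way. Comparing derivatives of \<open>reach\<close> there orders the slopes at the
  blocking point, because \<open>\<tau> * (s - slope r z) * reach' = 2\<close> on the cone of \<open>r\<close>.\<close>

lemma right_pair_cases:
  assumes P: "finite P" "acausal P" "p \<in> P" "q \<in> P" "p \<noteq> q" and u: "uc q \<le> uc p"
    and right: "0 < (uc p - uc q) * s0 - (xc p - xc q)" and pos: "0 < reach p q s0"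
    and best: "\<And>r. r \<in> P - {p, q} \<Longrightarrow> reach p r s0 < reach p q s0"
  shows "(\<forall>s\<ge>s0. \<forall>r\<in>P - {p, q}. reach p r s < reach p q s) \<or> (\<exists>b z. top_of P p b q z)"
proof (cases "\<forall>s\<ge>s0. \<forall>r\<in>P - {p, q}. reach p r s < reach p q s")
  case False
  \<comment> \<open>The parameters at which a third event is level with \<open>q\<close> or ahead of
    it. The set is closed, so its infimum \<open>s1\<close> is the first blocking parameter.\<close>
  define S where "S = (\<Union>r\<in>P - {p, q}. {s0..} \<inter> {s. reach p q s \<le> reach p r s})"
  have sp: "\<not> causal p r" "\<not> causal r p" if "r \<in> P" "r \<noteq> p" for r
    using that P by (auto simp: acausal_def)
  have "S \<noteq> {}" using False by (force simp: S_def not_less)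
  moreover have "bdd_below S" by (auto simp: S_def bdd_below_def)
  moreover have "closed S" unfolding S_def using P
    by (intro closed_UN ballI closed_Int closed_atLeast closed_Collect_le continuous_intros) auto
  ultimately have "Inf S \<in> S" by (rule closed_contains_Inf)
  define s1 where "s1 = Inf S"
  obtain b where b: "b \<in> P - {p, q}" "s0 \<le> s1" "reach p q s1 \<le> reach p b s1"
    using \<open>Inf S \<in> S\<close> by (auto simp: S_def s1_def)
  have before: "reach p r s < reach p q s" if "s0 \<le> s" "s < s1" "r \<in> P - {p, q}" for r s
    using that cInf_lower[of s S] \<open>bdd_below S\<close> unfolding s1_def S_def by (force simp: not_le[symmetric])
  have s01: "s0 < s1" using b best[OF b(1)] by (auto simp: order.order_iff_strict)
  have at: "reach p r s1 \<le> reach p q s1" if r: "r \<in> P - {p, q}" for r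
  proof (rule ccontr)
    assume neg: "\<not> ?thesis"
    have "\<exists>s\<ge>s0. s \<le> s1 \<and> reach p r s - reach p q s = 0"
      using neg best[OF r] s01 by (intro IVT' continuous_intros) auto
    then obtain s where "s0 \<le> s" "s \<le> s1" "reach p r s = reach p q s" by auto
    with before[of s r] r neg show False by (cases "s = s1") auto
  qed
  define \<tau> where "\<tau> = 1 / reach p q s1"
  define D where "D = (\<lambda>r. (uc p - uc r) * s1 - (xc p - xc r))"
  define N where "N = (\<lambda>r. (xc p - xc r)\<^sup>2 - (uc p - uc r) * (vc p - vc r))"
  have N: "0 < N r" if "r \<in> P" "r \<noteq> p" for r using spacelike_pos[OF sp[OF that]] by (simp add: N_def)
  have mono: "(uc p - uc q) * s0 \<le> (uc p - uc q) * s1" using u s01 by (intro mult_left_mono) auto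
  then have Dq: "0 < D q" using right by (simp add: D_def)
  \<comment> \<open>\<open>reach p q\<close> increases from \<open>s0\<close> on, so it is still
    positive at \<open>s1\<close> and \<open>\<tau>\<close> is the distance at which the ray from
    \<open>p\<close> meets the cone of \<open>q\<close>.\<close>
  have "0 \<le> (s1 - s0) * ((uc p - uc q) * s1 + (uc p - uc q) * s0 - 2 * (xc p - xc q))"
    using right mono s01 by (intro mult_nonneg_nonneg) auto
  then have "reach p q s0 \<le> reach p q s1"
    unfolding reach_def using N[of q] P
    by (intro divide_right_mono) (auto simp: N_def power2_eq_square algebra_simps)
  then have qpos: "0 < reach p q s1" using pos by simp
  then have \<tau>: "0 < \<tau>" by (simp add: \<tau>_def)
  define z where "z = ray p s1 (uc p + \<tau>)"
  have on_cone: "\<tau> * reach p r s1 = 1" if "r \<in> P" "r \<noteq> p" "causal r z" for r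
  proof -
    have "1 \<le> \<tau> * reach p r s1" using causal_ray_iff[OF sp \<tau>] that by (simp add: z_def)
    moreover have "\<tau> * reach p r s1 \<le> \<tau> * reach p q s1"
      using at[of r] \<tau> that by (cases "r = q") (auto intro: mult_left_mono)
    ultimately show ?thesis using qpos by (simp add: \<tau>_def)
  qed
  \<comment> \<open>\<open>D r / N r\<close> is half the derivative of \<open>reach p r\<close> at
    \<open>s1\<close>. Before \<open>s1\<close> the event \<open>q\<close> was strictly ahead, so an
    \<open>r\<close> that ties with it at \<open>s1\<close> must be catching up.\<close>
  have DN: "D q / N q \<le> D r / N r" if r: "r \<in> P" "r \<noteq> p" "causal r z" for r
  proof (cases "r = q")
    case False
    have eq: "reach p r s1 = reach p q s1" using on_cone[OF r] \<tau> qpos by (simp add: \<tau>_def field_simps)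
    show ?thesis
    proof (rule ccontr)
      assume "\<not> ?thesis"
      then have neg: "2 * D r / N r - 2 * D q / N q < 0" by simp
      have "((\<lambda>s. reach p r s - reach p q s) has_real_derivative (2 * D r / N r - 2 * D q / N q)) (at s1)"
        unfolding D_def N_def by (intro DERIV_diff DERIV_reach)
      from DERIV_neg_dec_left[OF this neg] obtain d where d: "0 < d"
        "\<And>h. 0 < h \<Longrightarrow> h < d \<Longrightarrow> reach p r s1 - reach p q s1 < reach p r (s1 - h) - reach p q (s1 - h)"
        by blast
      define h where "h = min (d / 2) (s1 - s0)"
      have "0 < h" "h < d" "s0 \<le> s1 - h" using d s01 by (auto simp: h_def)
      then show False using d(2)[of h] before[of "s1 - h" r] r False eq by auto
    qed
  qed simp
  have Dr: "0 < D r" if "r \<in> P" "r \<noteq> p" "causal r z" for r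
  proof -
    have "0 < D q / N q" using Dq N[of q] P by simp
    also note DN[OF that]
    finally show ?thesis using N[of r] that by (simp add: zero_less_divide_iff)
  qed
  have cone: "uc r < uc z" "ray r (slope r z) (uc z) = z" "slope r z = s1 - N r / (\<tau> * D r)"
    if "r \<in> P" "r \<noteq> p" "causal r z" for r
    unfolding z_def D_def N_def
    by (rule slope_on_cone[OF sp \<tau> on_cone]; use that Dr[OF that] in \<open>simp add: D_def\<close>)+
  have qz: "causal q z" "causal b z"
    unfolding z_def using causal_ray_iff[OF sp \<tau>] b P qpos
    by (auto simp: \<tau>_def field_simps)
  have lt: "slope r z < s1" if "r \<in> P" "r \<noteq> p" "causal r z" for r
    using cone(3)[OF that] N[of r] Dr[OF that] \<tau> that by simp
  have gt: "slope q z < slope r z" if r: "r \<in> P" "r \<noteq> p" "r \<noteq> q" "causal r z" for r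
  proof -
    have "N r / D r \<le> N q / D q"
      using DN[of r] r Dr[of r] N[of r] N[of q] Dq P by (simp add: field_simps)
    then have "N r / D r / \<tau> \<le> N q / D q / \<tau>" using \<tau> by (intro divide_right_mono) auto
    then have "slope q z \<le> slope r z" using cone(3)[of r] cone(3)[of q] r P qz by (simp add: mult.commute)
    moreover have "slope q z \<noteq> slope r z"
    proof
      assume "slope q z = slope r z"
      then have "causal q r \<or> causal r q"
        using cone(2)[of r] cone(2)[of q] r P qz ray_eq_causal[of q "slope q z" "uc z" r] by simp
      then show False using P r by (auto simp: acausal_def)
    qed
    ultimately show ?thesis by simp
  qed
  have pz: "slope p z = s1" "uc p < uc z" "ray p (slope p z) (uc z) = z"
    using \<tau> by (auto simp: z_def)
  have "\<not> chron a z" if "a \<in> P" for a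
  proof (cases "a = p")
    case True
    then show ?thesis by (simp add: z_def not_chron_ray)
  next
    case False
    show ?thesis
    proof
      assume "chron a z"
      then have "1 < \<tau> * reach p a s1" "causal a z"
        using chron_ray_imp[OF sp \<tau>] that False by (auto simp: z_def chron_causal)
      then show False using on_cone[of a] that False by simp
    qed
  qed
  then have "top_of P p b q z"
    using cone pz qz b P lt gt by (auto simp: top_of_def)
  then show ?thesis by blast
qed blast

text \<open>\<open>s\<close> is the slope of a light ray from \<open>p\<close>, the event born no
  earlier than \<open>q\<close>. The first inequality selects the boundary along which
  \<open>reach p q\<close> grows with \<open>s\<close>; the opposite sign is reduced to it by
  reflecting \<open>x\<close>.\<close>

definition right_pair :: "event set \<Rightarrow> event \<Rightarrow> event \<Rightarrow> bool" where
  "right_pair P p q \<longleftrightarrow> p \<in> P \<and> q \<in> P \<and> p \<noteq> q \<and> uc q \<le> uc p \<and>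
     (\<exists>s. 0 < (uc p - uc q) * s - (xc p - xc q) \<and> 0 < reach p q s \<and>
          (\<forall>r\<in>P - {p, q}. reach p r s < reach p q s))"

text \<open>A pair whose walk is never blocked has \<open>q\<close> strictly ahead for all large
  \<open>s\<close>, which leaves one \<open>q\<close> for each \<open>p\<close>. The blocked pairs
  come from tops, contributing \<open>2 * card P\<close>.\<close>

lemma card_right_pairs:
  assumes P: "finite P" "acausal P"
  shows "card {(p, q). right_pair P p q} \<le> 3 * card P"
proof -
  define T where "T = {(p, q). \<exists>b z. top_of P p b q z}"
  define A where "A = {(p, q). p \<in> P \<and> q \<in> P \<and> p \<noteq> q \<and>
    (\<exists>s0. \<forall>s\<ge>s0. \<forall>r\<in>P - {p, q}. reach p r s < reach p q s)}"
  have sub: "A \<subseteq> P \<times> P" "T \<subseteq> P \<times> P" by (auto simp: A_def T_def top_of_def)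
  then have fin: "finite A" "finite T" using P finite_subset by blast+
  have "inj_on fst A"
  proof (rule inj_onI)
    fix e e' assume e: "e \<in> A" "e' \<in> A" "fst e = fst e'"
    obtain p q q' where pq: "e = (p, q)" "e' = (p, q')" using e by (cases e, cases e') auto
    have "q = q'"
    proof (rule ccontr)
      assume "q \<noteq> q'"
      then have mem: "q' \<in> P - {p, q}" "q \<in> P - {p, q'}" using e pq by (auto simp: A_def)
      obtain a b where "\<forall>s\<ge>a. \<forall>r\<in>P - {p, q}. reach p r s < reach p q s"
        "\<forall>s\<ge>b. \<forall>r\<in>P - {p, q'}. reach p r s < reach p q' s" using e pq by (auto simp: A_def)
      then have "reach p q' (max a b) < reach p q (max a b)" "reach p q (max a b) < reach p q' (max a b)"
        using mem by auto
      then show False by simp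
    qed
    with pq show "e = e'" by simp
  qed
  then have "card A = card (fst ` A)" by (simp add: card_image)
  also have "\<dots> \<le> card P" using sub P by (intro card_mono) auto
  finally have cA: "card A \<le> card P" .
  have cT: "card T \<le> 2 * card P" using P by (rule card_tops) (simp add: T_def)
  have "{(p, q). right_pair P p q} \<subseteq> A \<union> T"
  proof safe
    fix p q assume "right_pair P p q" "(p, q) \<notin> T"
    moreover from this obtain s where "0 < (uc p - uc q) * s - (xc p - xc q)" "0 < reach p q s"
      "\<And>r. r \<in> P - {p, q} \<Longrightarrow> reach p r s < reach p q s" by (auto simp: right_pair_def)
    ultimately show "(p, q) \<in> A"
      using right_pair_cases[OF P, of p q s] by (auto simp: right_pair_def A_def T_def)
  qed
  then have "card {(p, q). right_pair P p q} \<le> card (A \<union> T)" using fin by (intro card_mono) auto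
  also have "\<dots> \<le> card A + card T" by (rule card_Un_le)
  finally show ?thesis using cA cT by simp
qed

definition mirror :: "event \<Rightarrow> event" where
  "mirror a = Event (- xc a) (uc a) (vc a)"

lemma mirror_sel [simp]:
  "xc (mirror a) = - xc a" "uc (mirror a) = uc a" "vc (mirror a) = vc a"
  by (simp_all add: mirror_def)

lemma mirror_eq_iff [simp]: "mirror a = mirror b \<longleftrightarrow> a = b"
  by (auto simp: mirror_def intro: event.expand)

lemma causal_mirror [simp]: "causal (mirror a) (mirror b) \<longleftrightarrow> causal a b"
proof -
  have "(xc a - xc b)\<^sup>2 = (xc b - xc a)\<^sup>2" by (rule power2_commute)
  then show ?thesis by (simp add: causal_def)
qed

lemma reach_mirror: "reach (mirror p) (mirror r) s = reach p r (- s)"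
proof -
  have "xc (mirror p) - xc (mirror r) = - (xc p - xc r)" by simp
  then show ?thesis
    by (simp only: reach_def mirror_sel(2,3) power2_minus mult_minus_left mult_minus_right)
qed

lemma card_left_pairs:
  assumes "finite P" "acausal P"
  shows "card {(p, q). right_pair (mirror ` P) (mirror p) (mirror q)} \<le> 3 * card P"
proof -
  have fin: "finite {(p, q). right_pair (mirror ` P) p q}"
    by (rule finite_subset[of _ "mirror ` P \<times> mirror ` P"]) (use assms in \<open>auto simp: right_pair_def\<close>)
  have "card {(p, q). right_pair (mirror ` P) (mirror p) (mirror q)} =
        card (map_prod mirror mirror ` {(p, q). right_pair (mirror ` P) (mirror p) (mirror q)})"
    by (rule card_image[symmetric]) (auto simp: inj_on_def)
  also have "\<dots> \<le> card {(p, q). right_pair (mirror ` P) p q}"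
    using fin by (intro card_mono) auto
  also have "\<dots> \<le> 3 * card (mirror ` P)"
    using assms by (intro card_right_pairs) (auto simp: acausal_def)
  also have "card (mirror ` P) = card P" by (intro card_image) (auto simp: inj_on_def)
  finally show ?thesis .
qed

text \<open>The degenerate witnesses: those on the ray from \<open>p\<close> in direction \<open>v\<close>, which has no slope.\<close>

definition bottom_pair :: "event set \<Rightarrow> event \<Rightarrow> event \<Rightarrow> bool" where
  "bottom_pair P p q \<longleftrightarrow> p \<in> P \<and> q \<in> P \<and> p \<noteq> q \<and>
     (\<exists>v. causal q (Event (xc p) (uc p) v) \<and> (\<forall>r\<in>P - {p, q}. \<not> causal r (Event (xc p) (uc p) v)))"

text \<open>For fixed \<open>p\<close> all witnesses lie on one light ray and are causally
  comparable, so the later of two witnesses would lie in the future of both partners.\<close>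

lemma card_bottom_pairs:
  assumes "finite P"
  shows "card {(p, q). bottom_pair P p q} \<le> card P"
proof -
  have uniq: "q = q'" if b: "bottom_pair P p q" "bottom_pair P p q'" for p q q'
  proof (rule ccontr)
    assume ne: "q \<noteq> q'"
    obtain v where v: "causal q (Event (xc p) (uc p) v)"
      "\<forall>r\<in>P - {p, q}. \<not> causal r (Event (xc p) (uc p) v)"
      using b(1) unfolding bottom_pair_def by blast
    obtain v' where v': "causal q' (Event (xc p) (uc p) v')"
      "\<forall>r\<in>P - {p, q'}. \<not> causal r (Event (xc p) (uc p) v')"
      using b(2) unfolding bottom_pair_def by blast
    have "q \<in> P - {p, q'}" "q' \<in> P - {p, q}" using b ne by (auto simp: bottom_pair_def)
    then have no: "\<not> causal q (Event (xc p) (uc p) v')" "\<not> causal q' (Event (xc p) (uc p) v)"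
      using v v' by blast+
    have "causal (Event (xc p) (uc p) v) (Event (xc p) (uc p) v') \<or>
          causal (Event (xc p) (uc p) v') (Event (xc p) (uc p) v)"
      by (auto simp: causal_def)
    then show False using v(1) v'(1) no causal_trans by blast
  qed
  have "inj_on fst {(p, q). bottom_pair P p q}" by (auto simp: inj_on_def dest: uniq)
  then have "card {(p, q). bottom_pair P p q} = card (fst ` {(p, q). bottom_pair P p q})"
    by (simp add: card_image)
  also have "\<dots> \<le> card P" using assms by (intro card_mono) (auto simp: bottom_pair_def)
  finally show ?thesis .
qed

section \<open>From common witnesses to bounded degree\<close>

text \<open>Move from \<open>z\<close> straight towards \<open>q\<close> until the future of
  \<open>p\<close> is left. The exit point stays in the future of \<open>q\<close>, and being in the
  past of \<open>z\<close> it acquires no further predecessors.\<close>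

lemma cone_exit:
  assumes pq: "\<not> causal p q" "\<not> causal q p" and z: "causal p z" "causal q z"
  obtains y where "causal p y" "causal q y" "causal y z"
    "(xc y - xc p)\<^sup>2 = (uc y - uc p) * (vc y - vc p)"
proof -
  define y where "y = (\<lambda>l. Event (xc q + l * (xc z - xc q)) (uc q + l * (uc z - uc q)) (vc q + l * (vc z - vc q)))"
  define \<phi> where "\<phi> = (\<lambda>l. (uc (y l) - uc p) * (vc (y l) - vc p) - (xc (y l) - xc p)\<^sup>2)"
  have "\<phi> 0 \<le> 0" using pq causal_iff_not_spacelike[of p q] by (auto simp: \<phi>_def y_def)
  moreover have "0 \<le> \<phi> 1" using z by (auto simp: \<phi>_def y_def causal_def)
  moreover have "continuous_on {0..1} \<phi>" unfolding \<phi>_def y_def event.sel by (intro continuous_intros)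
  ultimately obtain l where l: "0 \<le> l" "l \<le> 1" "\<phi> l = 0" using IVT'[of \<phi> 0 0 1] by auto
  have zq: "uc q \<le> uc z" "vc q \<le> vc z" "(xc z - xc q)\<^sup>2 \<le> (uc z - uc q) * (vc z - vc q)"
    using z by (auto simp: causal_def)
  have qy: "causal q (y l)"
    using zq l mult_left_mono[OF zq(3), of "l\<^sup>2"]
    by (auto simp: causal_def y_def power_mult_distrib power2_eq_square mult_ac)
  have d: "xc z - xc (y l) = (1 - l) * (xc z - xc q)" "uc z - uc (y l) = (1 - l) * (uc z - uc q)"
    "vc z - vc (y l) = (1 - l) * (vc z - vc q)" by (auto simp: y_def algebra_simps)
  have "0 \<le> uc z - uc (y l)" "0 \<le> vc z - vc (y l)" unfolding d using zq l by auto
  moreover have "(xc z - xc (y l))\<^sup>2 \<le> (uc z - uc (y l)) * (vc z - vc (y l))"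
    unfolding d using mult_left_mono[OF zq(3), of "(1 - l)\<^sup>2"]
    by (simp add: power_mult_distrib power2_eq_square mult_ac)
  ultimately have yz: "causal (y l) z" by (simp add: causal_def)
  have null: "(xc (y l) - xc p)\<^sup>2 = (uc (y l) - uc p) * (vc (y l) - vc p)" using l by (simp add: \<phi>_def)
  then have "causal p (y l) \<or> causal (y l) p" using causal_iff_not_spacelike by simp
  then have "causal p (y l)" using causal_trans[OF qy] pq by blast
  with qy yz null that show thesis by blast
qed

text \<open>After moving the witness onto the cone of \<open>p\<close>, it lies either in direction
  \<open>v\<close> or on a ray of some slope \<open>s\<close>, where the sign of \<open>D\<close>
  separates right from left. \<open>D\<close> cannot vanish, since
  \<open>D^2 = (uc p - uc q) * (reach p q s * N) + N\<close> and \<open>q\<close> is born no later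
  than \<open>p\<close>.\<close>

lemma neighbours_cases:
  assumes P: "acausal P" "p \<in> P" "q \<in> P" "p \<noteq> q" and u: "uc q \<le> uc p"
    and z: "{r \<in> P. causal r z} = {p, q}"
  shows "bottom_pair P p q \<or> right_pair P p q \<or> right_pair (mirror ` P) (mirror p) (mirror q)"
proof -
  have sp: "\<not> causal p r" "\<not> causal r p" if "r \<in> P" "r \<noteq> p" for r
    using that P by (auto simp: acausal_def)
  have pz: "causal p z" "causal q z" using z by auto
  obtain y where y: "causal p y" "causal q y" "causal y z"
    "(xc y - xc p)\<^sup>2 = (uc y - uc p) * (vc y - vc p)"
    using cone_exit[OF sp pz] P by metis
  have others: "\<not> causal r y" if "r \<in> P - {p, q}" for r
    using causal_trans[OF _ y(3), of r] that z by blast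
  show ?thesis
  proof (cases "uc y = uc p")
    case True
    with y have "y = Event (xc p) (uc p) (vc y)" by (intro event.expand) auto
    with y others P have "bottom_pair P p q" unfolding bottom_pair_def by metis
    then show ?thesis by simp
  next
    case False
    define s \<tau> where "s = slope p y" "\<tau> = uc y - uc p"
    have \<tau>: "0 < \<tau>" using y False by (simp add: s_\<tau>_def causal_def)
    have ys: "y = ray p s (uc p + \<tau>)" using ray_slope[OF _ y(4)] \<tau> by (simp add: s_\<tau>_def)
    have q: "1 \<le> \<tau> * reach p q s" using causal_ray_iff[OF sp \<tau>] y P ys by auto
    have r: "\<tau> * reach p r s < 1" if "r \<in> P - {p, q}" for r
      using causal_ray_iff[OF sp \<tau>, of r s] others[OF that] that ys by auto
    have lt: "reach p r s < reach p q s" if "r \<in> P - {p, q}" for r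
      using r[OF that] q \<tau> by (smt (verit) mult_left_mono)
    have pos: "0 < reach p q s" using q \<tau> by (smt (verit) zero_less_mult_iff)
    define D where "D = (uc p - uc q) * s - (xc p - xc q)"
    define N where "N = (xc p - xc q)\<^sup>2 - (uc p - uc q) * (vc p - vc q)"
    have N: "0 < N" unfolding N_def using spacelike_pos[OF sp] P by simp
    have "D\<^sup>2 = (uc p - uc q) * (reach p q s * N) + N"
    proof -
      have eq: "reach p q s * N = (uc p - uc q) * s\<^sup>2 - 2 * (xc p - xc q) * s + (vc p - vc q)"
        using N by (simp add: reach_def N_def)
      show ?thesis unfolding eq unfolding D_def N_def by (simp add: power2_eq_square algebra_simps)
    qed
    then have "0 < D\<^sup>2" using N pos u by (simp add: add_nonneg_pos)
    then have "0 < D \<or> D < 0" by auto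
    then show ?thesis
    proof
      assume "0 < D"
      then have "right_pair P p q" using P u pos lt by (auto simp: right_pair_def D_def)
      then show ?thesis by simp
    next
      assume "D < 0"
      then have "right_pair (mirror ` P) (mirror p) (mirror q)"
        unfolding right_pair_def
      proof (intro conjI exI[of _ "- s"] ballI)
        fix r assume "r \<in> mirror ` P - {mirror p, mirror q}"
        then obtain r' where "r = mirror r'" "r' \<in> P - {p, q}" by auto
        then show "reach (mirror p) r (- s) < reach (mirror p) (mirror q) (- s)"
          using lt by (simp add: reach_mirror)
      qed (use P u pos in \<open>auto simp: reach_mirror D_def\<close>)
      then show ?thesis by simp
    qed
  qed
qed

text \<open>With \<open>uc q \<le> uc p\<close>, bottom, right and left pairs give
  \<open>1 + 3 + 3 = 7\<close> per event; swapping the entries doubles this.\<close>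

lemma card_neighbour_pairs:
  assumes P: "finite P" "acausal P"
  shows "card {(p, q) \<in> P \<times> P. p \<noteq> q \<and> (\<exists>z. {r \<in> P. causal r z} = {p, q})} \<le> 14 * card P"
    (is "card ?E \<le> _")
proof -
  define E where "E = {(p, q) \<in> ?E. uc q \<le> uc p}"
  define R B L where d: "R = {(p, q). right_pair P p q}" "B = {(p, q). bottom_pair P p q}"
    "L = {(p, q). right_pair (mirror ` P) (mirror p) (mirror q)}"
  have "R \<subseteq> P \<times> P" "L \<subseteq> P \<times> P" "B \<subseteq> P \<times> P"
    by (auto simp: d right_pair_def bottom_pair_def)
  then have fin: "finite R" "finite L" "finite B" using P finite_subset by blast+
  have finE: "finite E" by (rule finite_subset[of _ "P \<times> P"]) (use P in \<open>auto simp: E_def\<close>)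
  have "E \<subseteq> B \<union> (R \<union> L)"
  proof (rule subsetI)
    fix e assume "e \<in> E"
    moreover obtain p q where "e = (p, q)" by fastforce
    ultimately show "e \<in> B \<union> (R \<union> L)"
      using neighbours_cases[OF P(2), of p q] unfolding E_def d by blast
  qed
  then have "card E \<le> card (B \<union> (R \<union> L))" using fin by (intro card_mono) auto
  also have "\<dots> \<le> card B + (card R + card L)"
    by (meson add_left_mono card_Un_le order_trans)
  also have "\<dots> \<le> 7 * card P"
    using card_right_pairs[OF P] card_left_pairs[OF P] card_bottom_pairs[OF P(1)] by (simp add: d)
  finally have 7: "card E \<le> 7 * card P" .
  have "?E \<subseteq> E \<union> prod.swap ` E"
  proof (rule subsetI)
    fix e assume "e \<in> ?E"
    then obtain p q z where pq: "e = (p, q)" "p \<in> P" "q \<in> P" "p \<noteq> q" "{r \<in> P. causal r z} = {p, q}"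
      by blast
    then have "(p, q) \<in> E \<or> (q, p) \<in> E" unfolding E_def by (auto simp: insert_commute)
    then show "e \<in> E \<union> prod.swap ` E" unfolding pq(1) by (metis UnCI image_eqI swap_simp)
  qed
  then have "card ?E \<le> card (E \<union> prod.swap ` E)" using finE by (intro card_mono) auto
  also have "\<dots> \<le> card E + card (prod.swap ` E)" by (rule card_Un_le)
  also have "\<dots> \<le> card E + card E" using finE by (simp add: card_image_le)
  finally show ?thesis using 7 by simp
qed

lemma low_degree:
  assumes "finite P" "P \<noteq> {}"
  shows "\<exists>p\<in>P. card {q \<in> P. q \<noteq> p \<and> (\<exists>z. {r \<in> P. causal r z} = {p, q})} < 15"
proof (cases "acausal P")
  case True
  show ?thesis
  proof (rule ccontr)
    define N where "N = (\<lambda>p. {q \<in> P. q \<noteq> p \<and> (\<exists>z. {r \<in> P. causal r z} = {p, q})})"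
    assume "\<not> ?thesis"
    then have "(\<Sum>p\<in>P. 15) \<le> (\<Sum>p\<in>P. card (N p))"
      by (intro sum_mono) (auto simp: N_def not_less)
    also have "\<dots> = card (Sigma P N)"
      using assms by (intro card_SigmaI[symmetric]) (auto simp: N_def)
    also have "Sigma P N = {(p, q) \<in> P \<times> P. p \<noteq> q \<and> (\<exists>z. {r \<in> P. causal r z} = {p, q})}"
      by (auto simp: N_def)
    finally have "15 * card P \<le> 14 * card P"
      using card_neighbour_pairs[OF assms(1) True] by simp
    then show False using assms by (simp add: card_gt_0_iff)
  qed
next
  case False
  then obtain a b where ab: "a \<in> P" "b \<in> P" "causal a b" "a \<noteq> b" by (auto simp: acausal_def)
  \<comment> \<open>Every causal past containing \<open>b\<close> contains \<open>a\<close>, so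
    \<open>a\<close> is the only possible neighbour of \<open>b\<close>.\<close>
  have "{q \<in> P. q \<noteq> b \<and> (\<exists>z. {r \<in> P. causal r z} = {b, q})} \<subseteq> {a}"
  proof safe
    fix q z assume "q \<noteq> b" "{r \<in> P. causal r z} = {b, q}"
    then have "causal b z" "{r \<in> P. causal r z} = {b, q}" by auto
    then have "a \<in> {b, q}" using ab causal_trans[of a b z] by blast
    then show "q = a" using ab by simp
  qed
  from card_mono[OF _ this] show ?thesis using ab by (intro bexI[of _ b]) auto
qed

section \<open>Discs as events\<close>

lemma cball_Int_cball_nonempty_iff:
  fixes a b :: "'a::real_normed_vector"
  assumes "0 \<le> r" "0 \<le> s"
  shows "cball a r \<inter> cball b s \<noteq> {} \<longleftrightarrow> dist a b \<le> r + s"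
proof
  show "dist a b \<le> r + s" if "cball a r \<inter> cball b s \<noteq> {}"
    using that disjoint_cballI[of r s a b] by (meson not_le)
next
  assume le: "dist a b \<le> r + s"
  show "cball a r \<inter> cball b s \<noteq> {}"
  proof (cases "r + s = 0")
    case True
    then have "a = b" using le zero_le_dist[of a b] by simp
    then have "a \<in> cball a r \<inter> cball b s" using assms by simp
    then show ?thesis by blast
  next
    case False
    define l where "l = r / (r + s)"
    have l: "0 \<le> l" "0 \<le> 1 - l" "l * (r + s) = r" "(1 - l) * (r + s) = s"
      using assms False by (auto simp: l_def field_simps)
    have "dist a (a + l *\<^sub>R (b - a)) = l * dist a b"
      using l by (simp add: dist_norm norm_minus_commute)
    also have "\<dots> \<le> r" using mult_left_mono[OF le l(1)] l by simp
    finally have 1: "a + l *\<^sub>R (b - a) \<in> cball a r" by simp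
    have "b - (a + l *\<^sub>R (b - a)) = (1 - l) *\<^sub>R (b - a)" by (simp add: algebra_simps)
    then have "dist b (a + l *\<^sub>R (b - a)) = (1 - l) * dist a b"
      using l by (simp add: dist_norm norm_minus_commute)
    also have "\<dots> \<le> s" using mult_left_mono[OF le l(2)] l by simp
    finally have "a + l *\<^sub>R (b - a) \<in> cball b s" by simp
    with 1 show ?thesis by blast
  qed
qed

text \<open>A disc of the family has time \<open>-r\<close>; a query disc of radius \<open>s\<close> has time \<open>s\<close>, hence
  appears below with radius argument \<open>- s\<close>.\<close>

definition center_event :: "real^2 \<Rightarrow> real \<Rightarrow> event" where
  "center_event c r = Event (c $ 1) (c $ 2 - r) (- (c $ 2) - r)"

lemma causal_center_event:
  assumes "0 < r" "0 < s"
  shows "causal (center_event c r) (center_event b (- s)) \<longleftrightarrow> cball c r \<inter> cball b s \<noteq> {}"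
proof -
  define X Y where "X = b $ 1 - c $ 1" "Y = b $ 2 - c $ 2"
  have "(dist c b)\<^sup>2 = X\<^sup>2 + Y\<^sup>2"
    by (simp add: X_Y_def dist_norm norm_vec_def L2_set_def sum_2 power2_commute)
  then have "dist c b \<le> r + s \<longleftrightarrow> X\<^sup>2 + Y\<^sup>2 \<le> (r + s)\<^sup>2"
    using assms by (metis abs_le_square_iff abs_of_nonneg add_nonneg_nonneg less_imp_le zero_le_dist)
  also have "\<dots> \<longleftrightarrow> X\<^sup>2 \<le> (r + s + Y) * (r + s - Y)"
    by (simp add: power2_eq_square algebra_simps)
  also have "\<dots> \<longleftrightarrow> causal (center_event c r) (center_event b (- s))"
  proof -
    have "0 \<le> r + s + Y \<and> 0 \<le> r + s - Y" if "X\<^sup>2 \<le> (r + s + Y) * (r + s - Y)"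
    proof -
      have "0 \<le> (r + s + Y) * (r + s - Y)" using that by (rule order_trans[OF zero_le_power2])
      then show ?thesis using assms by (auto simp: zero_le_mult_iff)
    qed
    then show ?thesis by (auto simp: causal_def center_event_def X_Y_def algebra_simps)
  qed
  finally show ?thesis using cball_Int_cball_nonempty_iff[of r s c b] assms by simp
qed

lemma center_event_inject:
  assumes "center_event c r = center_event c' r'"
  shows "c = c' \<and> r = r'"
proof -
  have "c $ 1 = c' $ 1" "c $ 2 - r = c' $ 2 - r'" "c $ 2 + r = c' $ 2 + r'"
    using assms by (auto simp: center_event_def)
  then show ?thesis by (simp add: vec_eq_iff forall_2)
qed

lemma discs_colorable:
  assumes "finite P" "\<forall>D\<in>P. closed_disc D"
  shows "\<exists>f::(real^2) set \<Rightarrow> nat. (\<forall>D\<in>P. f D < 15) \<and>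
     (\<forall>h\<in>(\<lambda>B. {D. D \<inter> B \<noteq> {}}) ` Collect closed_disc.
        (\<forall>a\<in>h \<inter> P. \<forall>b\<in>h \<inter> P. f a = f b) \<longrightarrow> card (h \<inter> P) \<le> 1)"
proof -
  obtain c r where cr: "\<And>D. D \<in> P \<Longrightarrow> 0 < r D \<and> D = cball (c D) (r D)"
    using assms(2) unfolding closed_disc_def by metis
  define ev where "ev = (\<lambda>D. center_event (c D) (r D))"
  have inj: "inj_on ev P"
    by (rule inj_onI) (metis ev_def center_event_inject cr)
  define H where "H = range (\<lambda>z. {e. causal e z})"
  have "\<exists>f::event \<Rightarrow> nat. (\<forall>a\<in>ev ` P. f a < 15) \<and>
          (\<forall>h\<in>H. (\<forall>a\<in>h \<inter> ev ` P. \<forall>b\<in>h \<inter> ev ` P. f a = f b) \<longrightarrow> card (h \<inter> ev ` P) \<le> 1)"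
  proof (rule degenerate_colorable)
    fix Q assume "Q \<subseteq> ev ` P" "Q \<noteq> {}"
    then have "finite Q" using assms finite_subset by blast
    then show "\<exists>p\<in>Q. card {q \<in> Q. q \<noteq> p \<and> (\<exists>h\<in>H. h \<inter> Q = {p, q})} < 15"
      using low_degree[of Q] \<open>Q \<noteq> {}\<close> by (simp add: H_def Int_def conj_commute)
  qed (use assms in simp)
  then obtain f :: "event \<Rightarrow> nat" where f: "\<And>a. a \<in> ev ` P \<Longrightarrow> f a < 15"
    and mono: "\<And>h. h \<in> H \<Longrightarrow> \<forall>a\<in>h \<inter> ev ` P. \<forall>b\<in>h \<inter> ev ` P. f a = f b \<Longrightarrow> card (h \<inter> ev ` P) \<le> 1"
    by metis
  have "card ({D. D \<inter> B \<noteq> {}} \<inter> P) \<le> 1"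
    if B: "closed_disc B" and same: "\<forall>a\<in>{D. D \<inter> B \<noteq> {}} \<inter> P. \<forall>b\<in>{D. D \<inter> B \<noteq> {}} \<inter> P. f (ev a) = f (ev b)" for B
  proof -
    obtain b s where bs: "0 < s" "B = cball b s" using B by (auto simp: closed_disc_def)
    define h where "h = {e. causal e (center_event b (- s))}"
    have "ev D \<in> h \<longleftrightarrow> D \<inter> B \<noteq> {}" if "D \<in> P" for D
      using causal_center_event[of "r D" s "c D" b] bs cr[OF that] by (simp add: h_def ev_def)
    then have eq: "h \<inter> ev ` P = ev ` ({D. D \<inter> B \<noteq> {}} \<inter> P)" by auto
    have "\<forall>x\<in>h \<inter> ev ` P. \<forall>y\<in>h \<inter> ev ` P. f x = f y"
      unfolding eq ball_simps using same by blast
    then have "card (h \<inter> ev ` P) \<le> 1" by (rule mono[rotated]) (simp add: H_def h_def)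
    moreover have "card (ev ` ({D. D \<inter> B \<noteq> {}} \<inter> P)) = card ({D. D \<inter> B \<noteq> {}} \<inter> P)"
      by (rule card_image[OF inj_on_subset[OF inj]]) simp
    ultimately show ?thesis using eq by simp
  qed
  moreover have "\<forall>D\<in>P. f (ev D) < 15" using f by blast
  ultimately show ?thesis by (intro exI[of _ "\<lambda>D. f (ev D)"]) blast
qed

text \<open>With 15 colours each list entry contributes a factor \<open>14/15\<close>. The constant
  is chosen so that every disc weighs at most \<open>1/n^2\<close>, for a total of at most
  \<open>1/n < 1\<close>.\<close>

lemma disc_list_coloring:
  assumes n: "n \<ge> 2" and F: "finite F" "card F = n" "\<forall>D\<in>F. closed_disc D"
    and L: "\<forall>D\<in>F. finite (L D) \<and> real (card (L D)) \<ge> 2 / ln (15 / 14) * ln (real n)"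
  shows "\<exists>col. (\<forall>D\<in>F. col D \<in> L D) \<and> cf_disc_coloring F (col :: (real^2) set \<Rightarrow> nat)"
proof -
  define H where "H = (\<lambda>B. {D. D \<inter> B \<noteq> {}}) ` Collect closed_disc"
  have weight: "(1 - 1 / real 15) ^ card (L D) \<le> 1 / (real n)\<^sup>2" if "D \<in> F" for D
  proof -
    have ln: "0 < ln (15 / 14 :: real)" by simp
    have "2 * ln (real n) \<le> ln (15 / 14) * real (card (L D))"
      using L that ln by (simp add: pos_divide_le_eq mult.commute)
    also have "\<dots> = ln ((15 / 14) ^ card (L D))" by (simp add: ln_realpow)
    finally have "ln ((real n)\<^sup>2) \<le> ln ((15 / 14) ^ card (L D))" using n by (simp add: ln_realpow)
    then have "(real n)\<^sup>2 \<le> (15 / 14) ^ card (L D)" using n by simp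
    then have "1 / (15 / 14) ^ card (L D) \<le> 1 / (real n)\<^sup>2"
      using n by (intro divide_left_mono) auto
    then show ?thesis by (simp add: power_divide)
  qed
  have "(\<Sum>D\<in>F. (1 - 1 / real 15) ^ card (L D)) \<le> (\<Sum>D\<in>F. 1 / (real n)\<^sup>2)"
    by (intro sum_mono weight)
  also have "\<dots> = 1 / real n" using F n by (simp add: power2_eq_square)
  also have "\<dots> < 1" using n by simp
  finally have "(\<Sum>D\<in>F. (1 - 1 / real 15) ^ card (L D)) < 1" .
  moreover have "\<exists>f::(real^2) set \<Rightarrow> nat. (\<forall>a\<in>P. f a < 15) \<and>
          (\<forall>h\<in>H. (\<forall>a\<in>h \<inter> P. \<forall>b\<in>h \<inter> P. f a = f b) \<longrightarrow> card (h \<inter> P) \<le> 1)" if "P \<subseteq> F" for P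
    unfolding H_def using that F by (intro discs_colorable) (auto intro: finite_subset)
  ultimately have "\<exists>col. (\<forall>D\<in>F. col D \<in> L D) \<and>
          (\<forall>h\<in>H. h \<inter> F \<noteq> {} \<longrightarrow> (\<exists>v\<in>h \<inter> F. \<forall>w\<in>h \<inter> F. w \<noteq> v \<longrightarrow> col w \<noteq> col v))"
    using F L by (intro list_conflict_free[of "\<Union>(L ` F)" 15]) auto
  then obtain col where col: "\<forall>D\<in>F. col D \<in> L D"
    "\<And>h. h \<in> H \<Longrightarrow> h \<inter> F \<noteq> {} \<Longrightarrow> \<exists>v\<in>h \<inter> F. \<forall>w\<in>h \<inter> F. w \<noteq> v \<longrightarrow> col w \<noteq> col v"
    by metis
  have "hit_set F B = {D. D \<inter> B \<noteq> {}} \<inter> F" for B by (auto simp: hit_set_def)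
  then have "cf_disc_coloring F col"
    unfolding cf_disc_coloring_def using col(2) by (simp add: H_def)
  with col(1) show ?thesis by blast
qed

section \<open>The lower bound\<close>

text \<open>If the whole block has a uniquely coloured point \<open>k\<close>, then on one side of
  \<open>k\<close> there remain \<open>2 ^ m\<close> consecutive points avoiding its colour, to
  which induction applies.\<close>

lemma interval_conflict_free_colors:
  fixes col :: "nat \<Rightarrow> 'c"
  assumes "finite Cs" "card Cs \<le> m" "\<And>k. a \<le> k \<Longrightarrow> k < a + 2 ^ m \<Longrightarrow> col k \<in> Cs"
  shows "\<exists>i j. a \<le> i \<and> i \<le> j \<and> j < a + 2 ^ m \<and>
          (\<forall>k\<in>{i..j}. \<exists>l\<in>{i..j}. l \<noteq> k \<and> col l = col k)"
  using assms
proof (induction m arbitrary: a Cs)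
  case 0
  then show ?case using "0.prems"(3)[of a] by auto
next
  case (Suc m)
  show ?case
  proof (rule ccontr)
    assume no: "\<not> ?thesis"
    have "\<not> (\<forall>k\<in>{a..a + 2 ^ Suc m - 1}. \<exists>l\<in>{a..a + 2 ^ Suc m - 1}. l \<noteq> k \<and> col l = col k)"
      proof -
      have "a \<le> a + 2 ^ Suc m - 1" "a + 2 ^ Suc m - 1 < a + 2 ^ Suc m"
        using zero_less_power[of "2::nat" "Suc m"] by linarith+
      with no show ?thesis by blast
    qed
    moreover have "{a..a + 2 ^ Suc m - 1} = {a..<a + 2 ^ Suc m}"
    proof (rule set_eqI)
      fix x
      have "0 < a + 2 ^ Suc m" by simp
      then have "x \<le> a + 2 ^ Suc m - 1 \<longleftrightarrow> x < a + 2 ^ Suc m" by linarith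
      then show "x \<in> {a..a + 2 ^ Suc m - 1} \<longleftrightarrow> x \<in> {a..<a + 2 ^ Suc m}" by simp
    qed
    ultimately obtain k where k: "a \<le> k" "k < a + 2 ^ Suc m"
      and uniq: "\<And>l. a \<le> l \<Longrightarrow> l < a + 2 ^ Suc m \<Longrightarrow> l \<noteq> k \<Longrightarrow> col l \<noteq> col k"
      by (metis atLeastLessThan_iff)
    define a' where "a' = (if a + 2 ^ m \<le> k then a else k + 1)"
    have a': "a \<le> a'" "a' + 2 ^ m \<le> a + 2 ^ Suc m" "\<And>l. a' \<le> l \<Longrightarrow> l < a' + 2 ^ m \<Longrightarrow> l \<noteq> k"
      using k by (auto simp: a'_def split: if_splits)
    have "\<exists>i j. a' \<le> i \<and> i \<le> j \<and> j < a' + 2 ^ m \<and>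
          (\<forall>k\<in>{i..j}. \<exists>l\<in>{i..j}. l \<noteq> k \<and> col l = col k)"
    proof (rule Suc.IH)
      show "card (Cs - {col k}) \<le> m" "finite (Cs - {col k})"
        using Suc.prems k by (auto simp: card_Diff_singleton)
      show "col l \<in> Cs - {col k}" if "a' \<le> l" "l < a' + 2 ^ m" for l
      proof -
        have "a \<le> l" "l < a + 2 ^ Suc m" "l \<noteq> k" using a' that by auto
        then show ?thesis using uniq[of l] Suc.prems(3)[of l] by simp
      qed
    qed
    then obtain i j where "a' \<le> i" "i \<le> j" "j < a' + 2 ^ m"
      "\<forall>k\<in>{i..j}. \<exists>l\<in>{i..j}. l \<noteq> k \<and> col l = col k" by blast
    with a' no show False by (meson le_trans less_le_trans)
  qed
qed

definition axis_disc :: "nat \<Rightarrow> (real^2) set" where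
  "axis_disc i = cball (vector [real i, 0]) (1 / 4)"

text \<open>The two radii \<open>1/4\<close> add a slack of \<open>1/2\<close> at each end, too
  small to reach another integer; the query disc has positive radius even for
  \<open>i = j\<close>.\<close>

lemma axis_disc_hits:
  assumes "i \<le> j"
  shows "axis_disc k \<inter> cball (vector [(real i + real j) / 2, 0]) ((real j - real i) / 2 + 1 / 4) \<noteq> {}
    \<longleftrightarrow> k \<in> {i..j}"
proof -
  have "dist (vector [real k, 0] :: real^2) (vector [(real i + real j) / 2, 0]) =
        \<bar>real k - (real i + real j) / 2\<bar>"
    by (simp add: dist_norm norm_vec_def L2_set_def sum_2)
  then have "axis_disc k \<inter> cball (vector [(real i + real j) / 2, 0]) ((real j - real i) / 2 + 1 / 4) \<noteq> {}
    \<longleftrightarrow> \<bar>real k - (real i + real j) / 2\<bar> \<le> 1 / 4 + ((real j - real i) / 2 + 1 / 4)"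
    unfolding axis_disc_def using assms by (subst cball_Int_cball_nonempty_iff) auto
  also have "\<dots> \<longleftrightarrow> real i \<le> real k + 1 / 2 \<and> real k \<le> real j + 1 / 2"
    unfolding abs_le_iff by (auto simp: field_simps)
  also have "\<dots> \<longleftrightarrow> k \<in> {i..j}" by auto
  finally show ?thesis .
qed

lemma inj_axis_disc: "inj axis_disc"
proof (rule injI)
  fix k l assume "axis_disc k = axis_disc l"
  then show "k = l" using axis_disc_hits[of k k k] axis_disc_hits[of k k l] by auto
qed

lemma closed_disc_cball: "0 < r \<Longrightarrow> closed_disc (cball c r)"
  by (auto simp: closed_disc_def)

lemma axis_discs_not_colorable:
  assumes "\<And>i. i < 2 ^ m \<Longrightarrow> col (axis_disc i) < m"
  shows "\<not> cf_disc_coloring (axis_disc ` {..<2 ^ m}) col"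
proof
  assume cf: "cf_disc_coloring (axis_disc ` {..<2 ^ m}) col"
  obtain i j where ij: "i \<le> j" "j < 2 ^ m"
    and rep: "\<And>k. k \<in> {i..j} \<Longrightarrow> \<exists>l\<in>{i..j}. l \<noteq> k \<and> col (axis_disc l) = col (axis_disc k)"
    using interval_conflict_free_colors[of "{..<m}" m 0 "col \<circ> axis_disc"] assms by auto
  define B :: "(real^2) set"
    where "B = cball (vector [(real i + real j) / 2, 0]) ((real j - real i) / 2 + 1 / 4)"
  have B: "closed_disc B" unfolding B_def using ij(1) by (intro closed_disc_cball add_nonneg_pos) auto
  have hit: "hit_set (axis_disc ` {..<2 ^ m}) B = axis_disc ` {i..j}"
  proof -
    have "axis_disc k \<inter> B \<noteq> {} \<longleftrightarrow> k \<in> {i..j}" for k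
      unfolding B_def by (rule axis_disc_hits[OF ij(1)])
    moreover have "hit_set (axis_disc ` {..<2 ^ m}) B = axis_disc ` {k \<in> {..<2 ^ m}. axis_disc k \<inter> B \<noteq> {}}"
      by (auto simp: hit_set_def)
    moreover have "{k \<in> {..<2 ^ m}. k \<in> {i..j}} = {i..j}" using ij by auto
    ultimately show ?thesis by presburger
  qed
  then have "hit_set (axis_disc ` {..<2 ^ m}) B \<noteq> {}" using ij by simp
  with cf B have "\<exists>D\<in>axis_disc ` {i..j}. \<forall>D'\<in>axis_disc ` {i..j}. D' \<noteq> D \<longrightarrow> col D' \<noteq> col D"
    unfolding cf_disc_coloring_def hit[symmetric] by blast
  then obtain k where k: "k \<in> {i..j}"
    "\<And>l. l \<in> {i..j} \<Longrightarrow> axis_disc l \<noteq> axis_disc k \<Longrightarrow> col (axis_disc l) \<noteq> col (axis_disc k)"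
    by blast
  from rep[OF k(1)] obtain l where "l \<in> {i..j}" "l \<noteq> k" "col (axis_disc l) = col (axis_disc k)" by blast
  with k(2) show False using injD[OF inj_axis_disc] by blast
qed

text \<open>All lists equal \<open>{..<m}\<close> and \<open>n = 2 ^ m\<close>, so their size is the
  binary logarithm of \<open>n\<close>; hence the constant \<open>1 / ln 2\<close>.\<close>

lemma many_colors_needed:
  "\<exists>(n::nat) (F::(real^2) set set) (L::(real^2) set \<Rightarrow> nat set).
     n \<ge> N \<and> n \<ge> 2 \<and> finite F \<and> card F = n \<and> (\<forall>D\<in>F. closed_disc D) \<and>
     (\<forall>D\<in>F. finite (L D) \<and> real (card (L D)) \<ge> 1 / ln 2 * ln (real n)) \<and>
     \<not> (\<exists>col. (\<forall>D\<in>F. col D \<in> L D) \<and> cf_disc_coloring F col)"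
proof (intro exI conjI)
  define m where "m = Suc N"
  define F where "F = axis_disc ` {..<2 ^ m}"
  have "N < 2 ^ N" by (rule less_exp)
  then show "N \<le> 2 ^ m" unfolding m_def power_Suc by linarith
  show "(2::nat) \<le> 2 ^ m" by (simp add: m_def)
  show "finite F" by (simp add: F_def)
  show "card F = 2 ^ m" unfolding F_def using card_image[OF inj_on_subset[OF inj_axis_disc subset_UNIV]] by simp
  show "\<forall>D\<in>F. closed_disc D" by (auto simp: F_def axis_disc_def closed_disc_cball)
  show "\<forall>D\<in>F. finite {..<m} \<and> real (card {..<m}) \<ge> 1 / ln 2 * ln (real (2 ^ m))"
    by (simp add: ln_realpow)
  show "\<not> (\<exists>col. (\<forall>D\<in>F. col D \<in> {..<m}) \<and> cf_disc_coloring F col)"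
    unfolding F_def using axis_discs_not_colorable[of m] by blast
qed

theorem theorem1p5:
  shows "(\<exists>C::real. \<forall>(n::nat) (F::(real^2) set set) (L::(real^2) set \<Rightarrow> nat set).
            n \<ge> 2 \<longrightarrow> finite F \<longrightarrow> card F = n \<longrightarrow> (\<forall>D\<in>F. closed_disc D) \<longrightarrow>
            (\<forall>D\<in>F. finite (L D) \<and> real (card (L D)) \<ge> C * ln (real n)) \<longrightarrow>
            (\<exists>col. (\<forall>D\<in>F. col D \<in> L D) \<and> cf_disc_coloring F col))
       \<and>
       (\<exists>c::real. c > 0 \<and> (\<forall>N::nat. \<exists>(n::nat) (F::(real^2) set set) (L::(real^2) set \<Rightarrow> nat set).
            n \<ge> N \<and> n \<ge> 2 \<and> finite F \<and> card F = n \<and> (\<forall>D\<in>F. closed_disc D) \<and>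
            (\<forall>D\<in>F. finite (L D) \<and> real (card (L D)) \<ge> c * ln (real n)) \<and>
            \<not> (\<exists>col. (\<forall>D\<in>F. col D \<in> L D) \<and> cf_disc_coloring F col)))"
proof (rule conjI, goal_cases)
  case 1
  show ?case by (intro exI[of _ "2 / ln (15 / 14)"] allI impI disc_list_coloring)
next
  case 2
  show ?case by (intro exI[of _ "1 / ln 2"] conjI allI many_colors_needed) simp
qed

end
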